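(* Let $\varphi$ be a linear fractional self-map of $\mathbb{D}$ which does not fall into any of the following categories: the identity, an elliptic automorphism, or a parabolic automorphism. If $f$ is a self-map of $\mathbb{D}$ different from a constant or the identity map, then $f\circ\varphi=\varphi\circ f$ holds if and only if $f$ is also a linear fractional transformation and has the same set of fixed points in $\widehat{\mathbb{C}}$ as $\varphi$. Moreover, in that case $f$ and $\varphi$ have the same dynamic type.
   Context: $\mathbb{D}$ is the open unit disk in $\mathbb{C}$ and $\widehat{\mathbb{C}}=\mathbb{C}\cup\{\infty\}$. A self-map of $\mathbb{D}$ is a function analytic in $\mathbb{D}$ with $f(\mathbb{D})\subset\mathbb{D}$. A linear fractional transformation is a map of the form $z\mapsto (az+b)/(cz+d)$ with $ad-bc\ne0$, also viewed as a bijection of $\widehat{\mathbb{C}}$. An automorphism is a bijective self-map of $\mathbb{D}$. The dynamic type of a non-identity self-map $g$ of $\mathbb{D}$ is one of: elliptic, if $g$ has a fixed point in $\mathbb{D}$; otherwise, letting $p\in\partial\mathbb{D}$ be its Denjoy-Wolff point (the unique point to which the iterates of $g$ converge uniformly on compact subsets of $\mathbb{D}$), hyperbolic if its (angular) derivative satisfies $g'(p)<1$ and parabolic if $g'(p)=1$ (always $0<g'(p)\le1$). *)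

theory Defs
  imports "HOL-Complex_Analysis.Complex_Analysis"
begin

abbreviation unit_disk :: "complex set"
  where "unit_disk \<equiv> ball 0 1"

text \<open>Only the values of a self-map on the disk matter; as a HOL function it is total, with
  arbitrary values elsewhere.\<close>

definition self_map :: "(complex \<Rightarrow> complex) \<Rightarrow> bool"
  where "self_map f \<longleftrightarrow> f holomorphic_on unit_disk \<and> f ` unit_disk \<subseteq> unit_disk"

definition identity_on_disk :: "(complex \<Rightarrow> complex) \<Rightarrow> bool"
  where "identity_on_disk f \<longleftrightarrow> (\<forall>z\<in>unit_disk. f z = z)"

definition disk_automorphism :: "(complex \<Rightarrow> complex) \<Rightarrow> bool"
  where "disk_automorphism f \<longleftrightarrow> self_map f \<and> bij_betw f unit_disk unit_disk"


section \<open>Linear fractional transformations of the Riemann sphere\<close>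

datatype sphere = Finite complex | Infinity

fun moebius :: "complex \<Rightarrow> complex \<Rightarrow> complex \<Rightarrow> complex \<Rightarrow> sphere \<Rightarrow> sphere"
  where
    "moebius a b c d (Finite z) =
       (if c * z + d = 0 then Infinity else Finite ((a * z + b) / (c * z + d)))"
  | "moebius a b c d Infinity = (if c = 0 then Infinity else Finite (a / c))"

definition linear_fractional :: "(sphere \<Rightarrow> sphere) \<Rightarrow> bool"
  where "linear_fractional F \<longleftrightarrow> (\<exists>a b c d. a * d - b * c \<noteq> 0 \<and> F = moebius a b c d)"

text \<open>A linear fractional \<open>F\<close> is determined by its values on the disk, so for such \<open>F\<close> the
  following relates \<open>f\<close> to at most one \<open>F\<close>.\<close>

definition extends_to_sphere :: "(complex \<Rightarrow> complex) \<Rightarrow> (sphere \<Rightarrow> sphere) \<Rightarrow> bool"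
  where "extends_to_sphere f F \<longleftrightarrow> (\<forall>z\<in>unit_disk. F (Finite z) = Finite (f z))"

definition fixed_points :: "(sphere \<Rightarrow> sphere) \<Rightarrow> sphere set"
  where "fixed_points F = {w. F w = w}"


section \<open>Dynamic type\<close>

definition denjoy_wolff_point :: "(complex \<Rightarrow> complex) \<Rightarrow> complex \<Rightarrow> bool"
  where "denjoy_wolff_point g p \<longleftrightarrow> norm p = 1 \<and>
    (\<forall>K. compact K \<and> K \<subseteq> unit_disk \<longrightarrow> uniform_limit K (\<lambda>n. g ^^ n) (\<lambda>_. p) sequentially)"

definition stolz_region :: "complex \<Rightarrow> real \<Rightarrow> complex set"
  where "stolz_region p M = {z \<in> unit_disk. norm (z - p) < M * (1 - norm z)}"

text \<open>For \<open>M \<le> 1\<close> the Stolz region is empty.\<close>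

definition has_angular_limit :: "(complex \<Rightarrow> complex) \<Rightarrow> complex \<Rightarrow> complex \<Rightarrow> bool"
  where "has_angular_limit h p l \<longleftrightarrow> (\<forall>M>1. (h \<longlongrightarrow> l) (at p within stolz_region p M))"

text \<open>The point \<open>q\<close> is the angular limit of \<open>g\<close> at \<open>p\<close>: convergence of the difference quotient
  forces \<open>g\<close> to tend to \<open>q\<close>. At a Denjoy-Wolff point, \<open>q = p\<close>.\<close>

definition has_angular_derivative :: "(complex \<Rightarrow> complex) \<Rightarrow> complex \<Rightarrow> complex \<Rightarrow> bool"
  where "has_angular_derivative g p l \<longleftrightarrow>
    (\<exists>q. norm q = 1 \<and> has_angular_limit (\<lambda>z. (g z - q) / (z - p)) p l)"

definition elliptic :: "(complex \<Rightarrow> complex) \<Rightarrow> bool"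
  where "elliptic g \<longleftrightarrow> self_map g \<and> \<not> identity_on_disk g \<and> (\<exists>z\<in>unit_disk. g z = z)"

definition hyperbolic :: "(complex \<Rightarrow> complex) \<Rightarrow> bool"
  where "hyperbolic g \<longleftrightarrow> self_map g \<and> \<not> (\<exists>z\<in>unit_disk. g z = z) \<and>
    (\<exists>p (l::real). denjoy_wolff_point g p \<and> has_angular_derivative g p (of_real l) \<and> l < 1)"

definition parabolic :: "(complex \<Rightarrow> complex) \<Rightarrow> bool"
  where "parabolic g \<longleftrightarrow> self_map g \<and> \<not> (\<exists>z\<in>unit_disk. g z = z) \<and>
    (\<exists>p. denjoy_wolff_point g p \<and> has_angular_derivative g p 1)"

definition same_dynamic_type :: "(complex \<Rightarrow> complex) \<Rightarrow> (complex \<Rightarrow> complex) \<Rightarrow> bool"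
  where "same_dynamic_type f g \<longleftrightarrow>
    elliptic f \<and> elliptic g \<or> hyperbolic f \<and> hyperbolic g \<or> parabolic f \<and> parabolic g"

end

theory Submission
  imports Defs
begin

text \<open>Let \<open>\<phi>(z) = (a z + b) / (c z + d)\<close>. The proof rests on one function attached to a self-map \<open>f\<close>,
\<open>k(z) = (f(z) (c z + d) - (a z + b)) / (z - f(z))\<close>. It is a constant \<open>k\<close> exactly when
\<open>f\<close> is the transformation with matrix \<open>[a + k, b; c, d + k]\<close>, that is, the matrix of
\<open>\<phi>\<close> plus a scalar. The fixed points of a transformation are the zeros of
\<open>c z\<^sup>2 + (d - a) z - b\<close>, with infinity as a zero when \<open>c = 0\<close>, and adding a scalar matrix does not
change this form. Hence \<open>f\<close> has the fixed points of \<open>\<phi>\<close> as soon as \<open>k\<close> is constant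
(\<open>commutant_imp_same_fixed_points\<close>). Conversely, equal fixed points force the two quadratic forms to
be proportional, so the two matrices commute (\<open>commute_if_same_fixed_points\<close>).

It remains to see that \<open>k\<close> is constant when \<open>f\<close> commutes with \<open>\<phi>\<close>.

If \<open>\<phi>\<close> fixes \<open>z0\<close> in the disk, then it fixes no other point there, so \<open>f\<close> fixes \<open>z0\<close> as well.
Commutation gives \<open>k \<circ> \<phi> = k\<close>, and \<open>\<phi>\<close> attracts nearby points to \<open>z0\<close>, because by the Schwarz
lemma a derivative of modulus 1 would make it an automorphism. At \<open>z0\<close> the function \<open>k\<close> has a
limit, as the derivative of \<open>f\<close> there is not 1. So \<open>k\<close> equals this limit near \<open>z0\<close>, and on the
disk by the identity theorem (\<open>commutant_elliptic\<close>).

Otherwise Brouwer's theorem on the closed disk gives a fixed point \<open>p\<close> on the circle. The Cayley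
transform sends \<open>p\<close> to infinity and the disk to the right half-plane, and \<open>\<phi>\<close> becomes
\<open>w \<mapsto> L w + e\<close> with \<open>L > 0\<close> and \<open>Re e \<ge> 0\<close>. The map \<open>f\<close> becomes a holomorphic self-map of the
half-plane commuting with it. Apply the Schwarz-Pick inequality to two points moved along the
orbits of this affine map, rescale, and pass to the limit. For \<open>L = 1\<close>, where \<open>Re e > 0\<close> since
\<open>\<phi>\<close> is not a parabolic automorphism, the limit says that \<open>f\<close> does not decrease the real part; then
\<open>f(w) - w\<close> is periodic with values in a half-plane, and the hyperbolic distance between translates
of two points tends to 0, so \<open>f\<close> is a translation (\<open>commute_with_translation_half_plane\<close>). For
\<open>L \<noteq> 1\<close> the limit is an inequality centred at the finite fixed point \<open>r\<close>, whose cases of equality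
on the horizontal line through \<open>r\<close> force \<open>f(w) = r + s (w - r)\<close> with \<open>s > 0\<close>
(\<open>commute_with_dilation_half_plane\<close>). In both cases \<open>k\<close> is constant, and the affine form shows
the dynamic type of \<open>f\<close>: translations are parabolic and dilations are hyperbolic.\<close>

section \<open>Transformations with equal fixed points\<close>

text \<open>Coefficients are kept explicit because the argument changes a matrix by a scalar. Nonvanishing of
the denominator is part of the notion, since division by zero would give the value 0.\<close>
definition disk_moebius :: "complex \<Rightarrow> complex \<Rightarrow> complex \<Rightarrow> complex \<Rightarrow> (complex \<Rightarrow> complex) \<Rightarrow> bool"
  where "disk_moebius a b c d g \<longleftrightarrow> a * d - b * c \<noteq> 0 \<and>
    (\<forall>z\<in>unit_disk. c * z + d \<noteq> 0 \<and> g z = (a * z + b) / (c * z + d))"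

lemma disk_moebius_iff_extends:
  "disk_moebius a b c d g \<longleftrightarrow> a * d - b * c \<noteq> 0 \<and> extends_to_sphere g (moebius a b c d)"
  unfolding disk_moebius_def extends_to_sphere_def by (auto split: if_splits)

text \<open>A common zero of \<open>c z + d\<close> and of the quadratic would make the determinant vanish, so clearing
denominators loses nothing.\<close>
lemma finite_fixed_point_moebius_iff:
  assumes "a * d - b * c \<noteq> 0"
  shows "Finite z \<in> fixed_points (moebius a b c d) \<longleftrightarrow> c * z\<^sup>2 + (d - a) * z - b = 0"
proof (cases "c * z + d = 0")
  case True
  have "c * z\<^sup>2 + (d - a) * z - b \<noteq> 0"
  proof
    assume "c * z\<^sup>2 + (d - a) * z - b = 0"
    then have "a * d - b * c = 0"
      using True by algebra
    with assms show False by simp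
  qed
  then show ?thesis using True by (simp add: fixed_points_def)
next
  case False
  then have "(a * z + b) / (c * z + d) = z \<longleftrightarrow> a * z + b = z * (c * z + d)"
    by (simp add: divide_eq_eq)
  also have "\<dots> \<longleftrightarrow> c * z\<^sup>2 + (d - a) * z - b = 0"
    by (auto simp: algebra_simps power2_eq_square)
  finally show ?thesis using False by (simp add: fixed_points_def)
qed

lemma infinite_fixed_point_moebius_iff:
  "Infinity \<in> fixed_points (moebius a b c d) \<longleftrightarrow> c = 0"
  by (simp add: fixed_points_def)

lemma quadratic_roots_exist:
  fixes c m b :: complex
  assumes "c \<noteq> 0"
  obtains r s where "\<And>z. c * z\<^sup>2 + m * z - b = c * (z - r) * (z - s)"
proof -
  define q where "q = csqrt (m\<^sup>2 + 4 * c * b)"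
  have q: "q * q = m\<^sup>2 + 4 * c * b"
    unfolding q_def by (metis power2_csqrt power2_eq_square)
  have "c * z\<^sup>2 + m * z - b = c * (z - (- m + q) / (2 * c)) * (z - (- m - q) / (2 * c))" for z
  proof -
    have "c * (z - (- m + q) / (2 * c)) * (z - (- m - q) / (2 * c))
        = (4 * c\<^sup>2 * z\<^sup>2 + 4 * c * m * z + m\<^sup>2 - q * q) / (4 * c)"
      using assms by (simp add: field_simps power2_eq_square)
    also have "\<dots> = c * z\<^sup>2 + m * z - b"
      unfolding q using assms by (simp add: field_simps power2_eq_square)
    finally show ?thesis by simp
  qed
  then show ?thesis by (rule that)
qed

text \<open>A nonzero binary quadratic form over the complex numbers is determined up to a factor by its zeros
on the sphere: two given distinct zeros are simple, and a single one is double. The case \<open>c = 0\<close>,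
where infinity is a zero, is treated apart.\<close>
lemma proportional_if_same_roots:
  fixes c m b c' m' b' :: complex
  assumes nz: "\<not> (c = 0 \<and> m = 0 \<and> b = 0)"
    and inf: "c = 0 \<longleftrightarrow> c' = 0"
    and roots: "\<And>z. c * z\<^sup>2 + m * z - b = 0 \<longleftrightarrow> c' * z\<^sup>2 + m' * z - b' = 0"
  obtains \<mu> where "c' = \<mu> * c" "m' = \<mu> * m" "b' = \<mu> * b"
proof (cases "c = 0")
  case False
  with inf have c': "c' \<noteq> 0" by simp
  obtain r s where rs: "\<And>z. c * z\<^sup>2 + m * z - b = c * (z - r) * (z - s)"
    using quadratic_roots_exist[OF False] by metis
  obtain r' s' where rs': "\<And>z. c' * z\<^sup>2 + m' * z - b' = c' * (z - r') * (z - s')"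
    using quadratic_roots_exist[OF c'] by metis
  have "z = r \<or> z = s \<longleftrightarrow> z = r' \<or> z = s'" for z
    using roots[of z] unfolding rs rs' using False c' by auto
  then have "(r' = r \<and> s' = s) \<or> (r' = s \<and> s' = r)" by metis
  then have eq: "c' * z\<^sup>2 + m' * z - b' = (c' / c) * (c * z\<^sup>2 + m * z - b)" for z
    unfolding rs rs' using False by (auto simp: field_simps)
  have "b' = (c' / c) * b" using eq[of 0] by simp
  moreover have "m' = (c' / c) * m" using eq[of 1] calculation False by (simp add: field_simps)
  ultimately show ?thesis using that[of "c' / c"] False by simp
next
  case True
  with inf have c': "c' = 0" by simp
  show ?thesis
  proof (cases "m = 0")
    case False
    then have "m' * (b / m) = b'" using roots[of "b / m"] True c' by simp
    moreover have "m' \<noteq> 0"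
    proof
      assume "m' = 0"
      then have "b' = 0" using calculation by simp
      then have "m * z = b" for z using roots[of z] True c' \<open>m' = 0\<close> by simp
      from this[of 0] this[of 1] False show False by simp
    qed
    ultimately show ?thesis using that[of "m' / m"] True c' False by auto
  next
    case m: True
    then have b: "b \<noteq> 0" using nz True by simp
    then have no: "m' * z \<noteq> b'" for z using roots[of z] True c' m by simp
    then have "m' = 0" by (metis mult.commute nonzero_mult_div_cancel_right times_divide_eq_right)
    moreover have "b' \<noteq> 0" using no[of 0] by simp
    ultimately show ?thesis using that[of "b' / b"] True c' m b by auto
  qed
qed

text \<open>Proportional fixed-point forms mean that one matrix is a multiple of the other plus a scalar
matrix, and such matrices commute.\<close>
lemma commute_if_same_fixed_points:
  assumes \<phi>: "disk_moebius a b c d \<phi>" and f: "disk_moebius a' b' c' d' f"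
    and maps: "\<phi> ` unit_disk \<subseteq> unit_disk" "f ` unit_disk \<subseteq> unit_disk"
    and nid: "\<not> identity_on_disk \<phi>"
    and same_fix: "fixed_points (moebius a' b' c' d') = fixed_points (moebius a b c d)"
    and z: "z \<in> unit_disk"
  shows "f (\<phi> z) = \<phi> (f z)"
proof -
  have det: "a * d - b * c \<noteq> 0" "a' * d' - b' * c' \<noteq> 0"
    using \<phi> f by (auto simp: disk_moebius_def)
  have nz: "\<not> (c = 0 \<and> d - a = 0 \<and> b = 0)"
    using nid \<phi> by (auto simp: identity_on_disk_def disk_moebius_def)
  obtain \<mu> where \<mu>: "c' = \<mu> * c" "d' - a' = \<mu> * (d - a)" "b' = \<mu> * b"
    using proportional_if_same_roots[OF nz, of c' "d' - a'" b']
      finite_fixed_point_moebius_iff[OF det(1)] finite_fixed_point_moebius_iff[OF det(2)]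
      infinite_fixed_point_moebius_iff same_fix by metis
  define x where "x = f z"
  define y where "y = \<phi> z"
  have in_disk: "x \<in> unit_disk" "y \<in> unit_disk"
    using maps z unfolding x_def y_def by blast+
  have den: "c * z + d \<noteq> 0" "c' * z + d' \<noteq> 0" "c * x + d \<noteq> 0" "c' * y + d' \<noteq> 0"
    using \<phi> f z in_disk by (auto simp: disk_moebius_def)
  have x: "x * (c' * z + d') = a' * z + b'" and y: "y * (c * z + d) = a * z + b"
    using \<phi> f z den by (auto simp: disk_moebius_def x_def y_def)
  have "f y = (a' * y + b') / (c' * y + d')" "\<phi> x = (a * x + b) / (c * x + d)"
    using \<phi> f in_disk by (auto simp: disk_moebius_def)
  moreover have "((a' * y + b') * (c * x + d) - (a * x + b) * (c' * y + d'))
      * ((c * z + d) * (c' * z + d')) = 0"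
    using x y \<mu> by algebra
  then have "(a' * y + b') * (c * x + d) = (a * x + b) * (c' * y + d')"
    using den by simp
  ultimately show ?thesis
    using den by (simp add: x_def y_def frac_eq_eq)
qed

text \<open>The hypothesis on \<open>k\<close> says that \<open>f(z) (c z + d + k) = (a + k) z + b\<close>. A vanishing determinant would
make \<open>f\<close> constant, or \<open>\<phi>\<close> the identity. The fixed-point form does not see the scalar \<open>k\<close>.\<close>
lemma commutant_imp_same_fixed_points:
  assumes \<phi>: "disk_moebius a b c d \<phi>" and nid: "\<not> identity_on_disk \<phi>"
    and f: "f holomorphic_on unit_disk" "\<not> f constant_on unit_disk"
    and k: "\<And>z. z \<in> unit_disk \<Longrightarrow> f z * (c * z + d) - (a * z + b) = k * (z - f z)"
  shows "disk_moebius (a + k) b c (d + k) f \<and>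
    fixed_points (moebius (a + k) b c (d + k)) = fixed_points (moebius a b c d)"
proof -
  have det0: "a * d - b * c \<noteq> 0"
    using \<phi> by (auto simp: disk_moebius_def)
  have eq: "f z * (c * z + (d + k)) = (a + k) * z + b" if "z \<in> unit_disk" for z
    using k[OF that] by algebra
  have det: "(a + k) * (d + k) - b * c \<noteq> 0"
  proof
    assume det: "(a + k) * (d + k) - b * c = 0"
    show False
    proof (cases "c = 0 \<and> d + k = 0")
      case True
      then have *: "(a + k) * z + b = 0" if "z \<in> unit_disk" for z
        using eq[OF that] by simp
      have b: "b = 0" using *[of 0] by simp
      have "a + k = 0" using *[of "1/2"] b by simp
      then have "a = d" using True by algebra
      with nid True b \<phi> show False
        by (auto simp: identity_on_disk_def disk_moebius_def)
    next
      case False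
      \<comment> \<open>The rows of the singular matrix are dependent, so \<open>f\<close> is constant off the zero of the
        denominator.\<close>
      obtain v where v: "a + k = v * c" "b = v * (d + k)"
      proof (cases "c = 0")
        case True
        then show ?thesis using that[of "b / (d + k)"] False det by auto
      next
        case c: False
        have "b = (a + k) / c * (d + k)" using c det by (simp add: field_simps)
        then show ?thesis using that[of "(a + k) / c"] c by simp
      qed
      have dis: "f z = v \<or> c * z + (d + k) = 0" if "z \<in> unit_disk" for z
      proof -
        have "(f z - v) * (c * z + (d + k)) = 0"
          using eq[OF that] v by algebra
        then show ?thesis by simp
      qed
      \<comment> \<open>\<open>e\<close> is the zero of the denominator; without one, any point will do.\<close>
      define e where "e = (if c = 0 then 2 else - (d + k) / c)"
      have e: "c * z + (d + k) = 0 \<longleftrightarrow> c \<noteq> 0 \<and> z = e" for z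
        using False by (auto simp: e_def field_simps eq_neg_iff_add_eq_0)
      have fv: "f z = v" if "z \<in> unit_disk - {e}" for z
        using dis[of z] e that by auto
      have "f z = v" if z: "z \<in> unit_disk" for z
      proof -
        have "open (unit_disk - {e})" by (simp add: open_delete)
        moreover have "unit_disk - {e} \<noteq> {}"
        proof
          assume "unit_disk - {e} = {}"
          moreover have "(0::complex) \<in> unit_disk" "(1/2::complex) \<in> unit_disk" by auto
          ultimately have "(0::complex) = e" "(1/2::complex) = e" by blast+
          then show False by simp
        qed
        ultimately show ?thesis
          using analytic_continuation_open[of "unit_disk - {e}" unit_disk f "\<lambda>_. v"] f(1) fv z
          by auto
      qed
      then show False using f(2) by (auto simp: constant_on_def)
    qed
  qed
  have "c * z + (d + k) \<noteq> 0" if "z \<in> unit_disk" for z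
  proof
    assume 0: "c * z + (d + k) = 0"
    then have "(a + k) * z + b = 0" using eq[OF that] by simp
    with 0 have "(a + k) * (d + k) - b * c = 0" by algebra
    with det show False by simp
  qed
  then have "disk_moebius (a + k) b c (d + k) f"
    unfolding disk_moebius_def using det eq by (auto simp: field_simps)
  moreover have "w \<in> fixed_points (moebius (a + k) b c (d + k)) \<longleftrightarrow> w \<in> fixed_points (moebius a b c d)" for w
    by (cases w) (simp_all add: finite_fixed_point_moebius_iff[OF det]
        finite_fixed_point_moebius_iff[OF det0] infinite_fixed_point_moebius_iff)
  ultimately show ?thesis by blast
qed

section \<open>Self-maps of the half-plane commuting with an affine map\<close>

abbreviation half_plane :: "complex set"
  where "half_plane \<equiv> {w. 0 < Re w}"

lemma half_plane_open: "open half_plane"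
  by (rule open_halfspace_Re_gt)

lemma half_plane_connected: "connected half_plane"
  by (intro convex_connected convex_halfspace_Re_gt)

text \<open>The identity behind the hyperbolic metric of the half-plane: the point \<open>- cnj w\<close> is the mirror
image of \<open>w\<close>, so this compares the distances of \<open>z\<close> to \<open>w\<close> and to its mirror image.\<close>
lemma norm_add_cnj_sq:
  "(norm (z + cnj w))\<^sup>2 = (norm (z - w))\<^sup>2 + 4 * Re z * Re w"
  unfolding cmod_power2 by (simp add: algebra_simps power2_eq_square)

lemma norm_diff_less_norm_add_cnj:
  assumes "0 < Re z" "0 < Re w"
  shows "norm (z - w) < norm (z + cnj w)"
proof -
  have "(norm (z - w))\<^sup>2 < (norm (z + cnj w))\<^sup>2"
    unfolding norm_add_cnj_sq using assms by simp
  then show ?thesis by (rule power_less_imp_less_base) simp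
qed

lemma add_cnj_nonzero:
  assumes "0 < Re z" "0 < Re w"
  shows "z + cnj w \<noteq> 0"
  using norm_diff_less_norm_add_cnj[OF assms] by auto

text \<open>The quotient \<open>|z - w| / |z + cnj w|\<close> is the pseudo-hyperbolic distance. Both sides are conjugated to
the disk so that \<open>w\<close> and \<open>f w\<close> go to 0, where the Schwarz lemma applies.\<close>
lemma schwarz_pick_half_plane:
  assumes hol: "f holomorphic_on half_plane" and maps: "f ` half_plane \<subseteq> half_plane"
    and z: "0 < Re z" and w: "0 < Re w"
  shows "norm (f z - f w) * norm (z + cnj w) \<le> norm (z - w) * norm (f z + cnj (f w))"
proof -
  have Re_f: "0 < Re (f u)" if "0 < Re u" for u
    using maps that by auto
  define C where "C a u = (u - a) / (u + cnj a)" for a u :: complex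
  define I where "I u = (w + cnj w * u) / (1 - u)" for u :: complex
  have C_disk: "norm (C a u) < 1" if "0 < Re a" "0 < Re u" for a u
    using norm_diff_less_norm_add_cnj[OF that(2,1)] add_cnj_nonzero[OF that(2,1)]
    by (simp add: C_def norm_divide)
  have I_half: "0 < Re (I u)" if u: "norm u < 1" for u
  proof -
    have nz: "1 - u \<noteq> 0" using u by auto
    have "Re (I u) = Re ((w + cnj w * u) * cnj (1 - u)) / (norm (1 - u))\<^sup>2"
      unfolding I_def by (subst complex_div_cnj) (simp only: Re_divide_of_real of_real_power [symmetric])
    also have "Re ((w + cnj w * u) * cnj (1 - u)) = Re w * (1 - (norm u)\<^sup>2)"
      unfolding cmod_power2 by (simp add: algebra_simps power2_eq_square)
    finally show ?thesis
      using w u nz by (simp add: abs_square_less_1 zero_less_divide_iff)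
  qed
  have I_C: "I (C w z) = z"
  proof -
    have nz: "z + cnj w \<noteq> 0" using add_cnj_nonzero[OF z w] .
    have nw: "w + cnj w \<noteq> 0" using add_cnj_nonzero[OF w w] .
    have "1 - C w z = (w + cnj w) / (z + cnj w)"
      using nz by (simp add: C_def field_simps)
    moreover have "w + cnj w * C w z = (w + cnj w) * z / (z + cnj w)"
      using nz by (simp add: C_def field_simps)
    ultimately show ?thesis using nz nw by (simp add: I_def)
  qed
  define g where "g = C (f w) \<circ> (f \<circ> I)"
  have "I holomorphic_on ball 0 1"
    unfolding I_def by (intro holomorphic_intros) auto
  moreover have "C (f w) holomorphic_on half_plane"
    unfolding C_def using add_cnj_nonzero[OF _ Re_f[OF w]]
    by (intro holomorphic_intros) auto
  moreover have "I ` ball 0 1 \<subseteq> half_plane" using I_half by auto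
  ultimately have "g holomorphic_on ball 0 1"
    unfolding g_def using hol maps
    by (intro holomorphic_on_compose_gen[where t = half_plane]) auto
  moreover have "g 0 = 0" by (simp add: g_def I_def C_def)
  moreover have "norm (g u) < 1" if "norm u < 1" for u
    using C_disk[OF Re_f[OF w] Re_f[OF I_half[OF that]]] by (simp add: g_def)
  ultimately have "norm (g (C w z)) \<le> norm (C w z)"
    using Schwarz_Lemma(1) C_disk[OF w z] by blast
  moreover have "g (C w z) = C (f w) (f z)"
    by (simp add: g_def I_C)
  ultimately have "norm (f z - f w) / norm (f z + cnj (f w)) \<le> norm (z - w) / norm (z + cnj w)"
    by (simp add: C_def norm_divide)
  then show ?thesis
    using add_cnj_nonzero[OF z w] add_cnj_nonzero[OF Re_f[OF z] Re_f[OF w]]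
    by (simp add: field_simps)
qed

text \<open>The same inequality after eliminating the difference terms. Unlike the previous form it stays
informative when one point goes to infinity and the distance tends to its supremum.\<close>
lemma schwarz_pick_half_plane_kernel:
  assumes hol: "f holomorphic_on half_plane" and maps: "f ` half_plane \<subseteq> half_plane"
    and z: "0 < Re z" and w: "0 < Re w"
  shows "(norm (f z + cnj (f w)))\<^sup>2 * Re z * Re w \<le> (norm (z + cnj w))\<^sup>2 * Re (f z) * Re (f w)"
proof -
  have "(norm (f z - f w) * norm (z + cnj w))\<^sup>2 \<le> (norm (z - w) * norm (f z + cnj (f w)))\<^sup>2"
    using schwarz_pick_half_plane[OF assms] by (intro power_mono) auto
  then have "((norm (f z + cnj (f w)))\<^sup>2 - 4 * Re (f z) * Re (f w)) * (norm (z + cnj w))\<^sup>2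
      \<le> ((norm (z + cnj w))\<^sup>2 - 4 * Re z * Re w) * (norm (f z + cnj (f w)))\<^sup>2"
    by (simp add: norm_add_cnj_sq power_mult_distrib)
  then show ?thesis by (simp add: algebra_simps)
qed

text \<open>As \<open>Re b > 0\<close>, the translates of any two points become arbitrarily close in the hyperbolic metric.
A holomorphic self-map of the half-plane with period \<open>b\<close> is therefore constant. This is applied
to \<open>f w - w + 1\<close>, once \<open>f\<close> is known not to decrease the real part.\<close>
lemma commute_with_translation_half_plane:
  assumes hol: "f holomorphic_on half_plane" and maps: "f ` half_plane \<subseteq> half_plane"
    and b: "0 < Re b"
    and comm: "\<And>w. 0 < Re w \<Longrightarrow> f (w + b) = f w + b"
  obtains e where "\<And>w. 0 < Re w \<Longrightarrow> f w = w + e"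
proof -
  have Re_f: "0 < Re (f u)" if "0 < Re u" for u
    using maps that by auto
  have Re_iter: "0 < Re (w + of_nat n * b)" if "0 < Re w" for w n
    using b that by (simp add: add_pos_nonneg)
  have iter: "f (w + of_nat n * b) = f w + of_nat n * b" if "0 < Re w" for w n
  proof (induction n)
    case (Suc n)
    have "f (w + of_nat (Suc n) * b) = f ((w + of_nat n * b) + b)" by (simp add: algebra_simps)
    also have "\<dots> = f w + of_nat (Suc n) * b"
      using comm[OF Re_iter[OF that]] Suc by (simp add: algebra_simps)
    finally show ?case .
  qed simp
  have inv: "(\<lambda>n. inverse (real n)) \<longlonglongrightarrow> 0"
    by (rule lim_inverse_n)
  have lim: "(\<lambda>n. (norm (u * of_real (inverse (real n)) + cnj b))\<^sup>2 * s * (t * inverse (real n) + Re b))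
      \<longlonglongrightarrow> (norm (u * of_real 0 + cnj b))\<^sup>2 * s * (t * 0 + Re b)" for u s t
    by (intro tendsto_intros inv)
  have Re_le: "Re z \<le> Re (f z)" if z: "0 < Re z" for z
  proof -
    \<comment> \<open>Divide the inequality between the points z and z + n b by the cube of n and let n grow.\<close>
    have resc: "(norm (u + cnj (u + of_nat n * b)))\<^sup>2 * s * Re (v + of_nat n * b) / real n ^ 3
        = (norm ((u + cnj u) * of_real (inverse (real n)) + cnj b))\<^sup>2 * s * (Re v * inverse (real n) + Re b)"
      if n: "n > 0" for u v s n
    proof -
      have "u + cnj (u + of_nat n * b) = of_nat n * ((u + cnj u) * of_real (inverse (real n)) + cnj b)"
        using n by (simp add: field_simps of_real_inverse)
      then have 1: "norm (u + cnj (u + of_nat n * b)) = real n * norm ((u + cnj u) * of_real (inverse (real n)) + cnj b)"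
        by (simp add: norm_mult)
      have 2: "Re (v + of_nat n * b) = real n * (Re v * inverse (real n) + Re b)"
        using n by (simp add: field_simps)
      show ?thesis unfolding 1 2 using n by (simp add: power_mult_distrib power2_eq_square power3_eq_cube)
    qed
    have "(norm ((f z + cnj (f z)) * of_real (inverse (real n)) + cnj b))\<^sup>2 * Re z * (Re z * inverse (real n) + Re b)
       \<le> (norm ((z + cnj z) * of_real (inverse (real n)) + cnj b))\<^sup>2 * Re (f z) * (Re (f z) * inverse (real n) + Re b)"
      if n: "n > 0" for n
    proof -
      have "(norm (f z + cnj (f z + of_nat n * b)))\<^sup>2 * Re z * Re (z + of_nat n * b)
          \<le> (norm (z + cnj (z + of_nat n * b)))\<^sup>2 * Re (f z) * Re (f z + of_nat n * b)"
        using schwarz_pick_half_plane_kernel[OF hol maps z Re_iter[OF z, of n]] iter[OF z]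
        by simp
      then show ?thesis
        unfolding resc[OF n, symmetric] by (rule divide_right_mono) simp
    qed
    then have "(norm ((f z + cnj (f z)) * of_real 0 + cnj b))\<^sup>2 * Re z * (Re z * 0 + Re b)
        \<le> (norm ((z + cnj z) * of_real 0 + cnj b))\<^sup>2 * Re (f z) * (Re (f z) * 0 + Re b)"
      by (intro LIMSEQ_le[OF lim lim] exI[of _ 1]) auto
    then have "((norm b)\<^sup>2 * Re b) * Re z \<le> ((norm b)\<^sup>2 * Re b) * Re (f z)"
      by (simp add: mult_ac)
    moreover have "0 < (norm b)\<^sup>2 * Re b"
      using b by (intro mult_pos_pos) auto
    ultimately show ?thesis by (simp only: mult_le_cancel_left_pos)
  qed
  \<comment> \<open>Adding 1 turns the weak inequality into values in the open half-plane.\<close>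
  define g where "g w = f w - w + 1" for w
  have g_hol: "g holomorphic_on half_plane"
    unfolding g_def by (intro holomorphic_intros hol)
  have Re_g: "0 < Re (g w)" if "0 < Re w" for w
    using Re_le[OF that] by (simp add: g_def)
  then have g_maps: "g ` half_plane \<subseteq> half_plane" by auto
  have const: "g z = g w" if z: "0 < Re z" and w: "0 < Re w" for z w
  proof (rule ccontr)
    assume ne: "g z \<noteq> g w"
    have bound: "2 * Re b * real n * norm (g z - g w) \<le> norm (z - w) * norm (g z + cnj (g w))" for n
    proof -
      have per: "g (u + of_nat n * b) = g u" if "0 < Re u" for u
        using iter[OF that] by (simp add: g_def)
      have "2 * Re b * real n \<le> Re ((z + of_nat n * b) + cnj (w + of_nat n * b))"
        using z w by simp
      also have "\<dots> \<le> norm ((z + of_nat n * b) + cnj (w + of_nat n * b))"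
        by (rule complex_Re_le_cmod)
      finally have "2 * Re b * real n * norm (g z - g w)
          \<le> norm (g z - g w) * norm ((z + of_nat n * b) + cnj (w + of_nat n * b))"
        by (subst mult.commute) (intro mult_left_mono, auto)
      also have "\<dots> \<le> norm (z - w) * norm (g z + cnj (g w))"
        using schwarz_pick_half_plane[OF g_hol g_maps Re_iter[OF z, of n] Re_iter[OF w, of n]]
        by (simp add: per z w)
      finally show ?thesis .
    qed
    have "0 < 2 * Re b * norm (g z - g w)" using b ne by simp
    then obtain n where "norm (z - w) * norm (g z + cnj (g w)) < real n * (2 * Re b * norm (g z - g w))"
      using reals_Archimedean3 by blast
    with bound[of n] show False by (simp add: algebra_simps)
  qed
  have "f w = w + (g 1 - 1)" if "0 < Re w" for w
    using const[OF that, of 1] unfolding g_def by (simp add: algebra_simps)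
  then show ?thesis by (rule that)
qed

text \<open>In the coordinate \<open>w - r\<close> both maps are homogeneous under \<open>L\<close>. Pushing \<open>z\<close> by \<open>L\<^sup>n\<close> and \<open>w\<close> by
\<open>L\<^sup>2\<^sup>n\<close> separates their scales, so that in the limit the Schwarz-Pick kernel
\<open>z + cnj w\<close> only sees \<open>w\<close>. The resulting inequality, for \<open>z = w\<close> with \<open>w - r\<close> real, forces
\<open>f w - r\<close> to be real; comparing two such points gives a constant ratio
\<open>(f w - r) / (w - r)\<close>.\<close>
lemma commute_with_expansion_half_plane:
  fixes L :: real and r :: complex
  assumes hol: "f holomorphic_on half_plane" and maps: "f ` half_plane \<subseteq> half_plane"
    and L: "1 < L" and r: "Re r \<le> 0"
    and comm: "\<And>w. 0 < Re w \<Longrightarrow> f (r + of_real L * (w - r)) = r + of_real L * (f w - r)"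
  obtains c :: real where "0 < c" "\<And>w. 0 < Re w \<Longrightarrow> f w = r + of_real c * (w - r)"
proof -
  have Re_f: "0 < Re (f u)" if "0 < Re u" for u
    using maps that by auto
  define E where "E n w = r + of_real (L ^ n) * (w - r)" for n w
  have Re_E: "0 < Re (E n w)" if w: "0 < Re w" for n w
  proof -
    have "1 * (Re w - Re r) \<le> L ^ n * (Re w - Re r)"
      using L w r by (intro mult_right_mono) auto
    then show ?thesis using w by (simp add: E_def)
  qed
  have E_Suc: "E (Suc n) w = r + of_real L * (E n w - r)" for n w
    by (simp add: E_def)
  have f_E: "f (E n w) = E n (f w)" if w: "0 < Re w" for n w
  proof (induction n)
    case (Suc n)
    then show ?case using comm[OF Re_E[OF w, of n]] by (simp only: E_Suc)
  qed (simp add: E_def)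
  have inv: "(\<lambda>n. inverse (L ^ n)) \<longlonglongrightarrow> 0"
    using LIMSEQ_inverse_realpow_zero[OF L] .
  \<comment> \<open>\<open>N A B s u t\<close> is one side of the kernel inequality at scales \<open>L\<^sup>n\<close> and \<open>L\<^sup>2\<^sup>n\<close>, divided by its
    growth rate \<open>L\<^sup>7\<^sup>n\<close>, as a function of \<open>t = L\<^sup>-\<^sup>n\<close>. It is continuous at \<open>t = 0\<close>.\<close>
  define N where "N A B s u t = (norm (of_real (2 * Re r * t\<^sup>2) + A * of_real t + cnj B))\<^sup>2
      * (Re r * t + s) * (Re r * t\<^sup>2 + u)" for A B :: complex and s u t :: real
  have lim: "(\<lambda>n. N A B s u (inverse (L ^ n))) \<longlonglongrightarrow> N A B s u 0" for A B s u
    unfolding N_def by (intro tendsto_intros inv)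
  have resc: "(norm (E n y + cnj (E (2 * n) v)))\<^sup>2 * Re (E n y') * Re (E (2 * n) v') / (L ^ n) ^ 7
      = N (y - r) (v - r) (Re (y' - r)) (Re (v' - r)) (inverse (L ^ n))" for n y v y' v'
  proof -
    define x where "x = L ^ n"
    have x: "x > 0" using L by (simp add: x_def)
    have x2: "L ^ (2 * n) = x\<^sup>2" by (simp add: x_def power_even_eq)
    have rr: "r + cnj r = of_real (2 * Re r)" by (simp add: complex_eq_iff)
    have "E n y + cnj (E (2 * n) v) = of_real (x\<^sup>2) *
        (of_real (2 * Re r * (inverse x)\<^sup>2) + (y - r) * of_real (inverse x) + cnj (v - r))"
    proof -
      have "E n y + cnj (E (2 * n) v) = (r + cnj r) + of_real x * (y - r) + of_real (x\<^sup>2) * cnj (v - r)"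
        unfolding E_def x2 by (simp add: x_def algebra_simps)
      moreover have "of_real (x\<^sup>2) * (of_real (2 * Re r * (inverse x)\<^sup>2) + A * of_real (inverse x) + B)
          = of_real (2 * Re r) + of_real x * A + of_real (x\<^sup>2) * B" for A B :: complex
        using x by (simp add: field_simps power2_eq_square)
      ultimately show ?thesis unfolding rr by metis
    qed
    then have 1: "norm (E n y + cnj (E (2 * n) v)) = x\<^sup>2 *
        norm (of_real (2 * Re r * (inverse x)\<^sup>2) + (y - r) * of_real (inverse x) + cnj (v - r))"
      by (simp only: norm_mult norm_of_real) simp
    have 2: "Re (E n y') = x * (Re r * inverse x + Re (y' - r))"
      using x by (simp add: E_def x_def[symmetric] algebra_simps)
    have 3: "Re (E (2 * n) v') = x\<^sup>2 * (Re r * (inverse x)\<^sup>2 + Re (v' - r))"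
      using x unfolding E_def x2 by (simp add: field_simps)
    have "(x\<^sup>2 * m)\<^sup>2 * (x * p) * (x\<^sup>2 * q) / x ^ 7 = m\<^sup>2 * p * q" for m p q
    proof -
      have eq: "(x\<^sup>2 * m)\<^sup>2 * (x * p) * (x\<^sup>2 * q) = m\<^sup>2 * p * q * x ^ 7"
        by (simp add: eval_nat_numeral)
      show ?thesis unfolding eq using x by simp
    qed
    then show ?thesis unfolding 1 2 3 N_def x_def[symmetric] .
  qed
  have key: "(norm (f w - r))\<^sup>2 * Re (z - r) * Re (w - r) \<le> (norm (w - r))\<^sup>2 * Re (f z - r) * Re (f w - r)"
    if z: "0 < Re z" and w: "0 < Re w" for z w
  proof -
    have "N (f z - r) (f w - r) (Re (z - r)) (Re (w - r)) (inverse (L ^ n))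
        \<le> N (z - r) (w - r) (Re (f z - r)) (Re (f w - r)) (inverse (L ^ n))" for n
      unfolding resc[symmetric]
      using schwarz_pick_half_plane_kernel[OF hol maps Re_E[OF z, of n] Re_E[OF w, of "2 * n"]] L
      unfolding f_E[OF z] f_E[OF w] by (intro divide_right_mono) auto
    then have "N (f z - r) (f w - r) (Re (z - r)) (Re (w - r)) 0
        \<le> N (z - r) (w - r) (Re (f z - r)) (Re (f w - r)) 0"
      using LIMSEQ_le[OF lim[of "f z - r" "f w - r" "Re (z - r)" "Re (w - r)"]
          lim[of "z - r" "w - r" "Re (f z - r)" "Re (f w - r)"]] by blast
    then show ?thesis by (simp add: N_def del: complex_cnj_diff)
  qed
  define h where "h x = Re (f (r + of_real x) - r)" for x
  have Re_pos: "0 < Re (r + of_real x)" if "- Re r < x" for x using that by simp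
  have h_pos: "0 < h x" if "- Re r < x" for x
    using Re_f[OF Re_pos[OF that]] r by (simp add: h_def)
  have f_h: "f (r + of_real x) - r = of_real (h x)" if x: "- Re r < x" for x
  proof -
    have x0: "0 < x" using x r by simp
    have "(norm (f (r + of_real x) - r))\<^sup>2 * x * x \<le> x\<^sup>2 * h x * h x"
      using key[OF Re_pos[OF x] Re_pos[OF x]] by (simp add: h_def)
    then have "(norm (f (r + of_real x) - r))\<^sup>2 \<le> (h x)\<^sup>2"
      using x0 by (simp add: power2_eq_square)
    then have "(Im (f (r + of_real x) - r))\<^sup>2 \<le> 0"
      unfolding cmod_power2 h_def by simp
    then have "Im (f (r + of_real x) - r) = 0" by simp
    then show ?thesis by (simp add: complex_eq_iff h_def)
  qed
  have ratio: "h x * y \<le> x * h y" if x: "- Re r < x" and y: "- Re r < y" for x y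
  proof -
    have x0: "0 < x" using x r by simp
    have "(h x)\<^sup>2 * y * x \<le> x\<^sup>2 * h y * h x"
      using key[OF Re_pos[OF y] Re_pos[OF x]] f_h[OF x] f_h[OF y] by simp
    then have "(h x * x) * (h x * y) \<le> (h x * x) * (x * h y)"
      by (simp add: power2_eq_square algebra_simps)
    then show ?thesis using h_pos[OF x] x0 by (simp add: mult_le_cancel_left)
  qed
  define x0 where "x0 = 1 - Re r"
  have x0: "- Re r < x0" "0 < x0" using r by (auto simp: x0_def)
  define c where "c = h x0 / x0"
  have h: "h x = c * x" if x: "- Re r < x" for x
    using ratio[OF x x0(1)] ratio[OF x0(1) x] x0 by (simp add: c_def field_simps)
  have "f w = r + of_real c * (w - r)" if w: "0 < Re w" for w
  proof -
    define \<xi> where "\<xi> = r + of_real x0"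
    have "\<xi> islimpt {r + of_real x | x. - Re r < x}"
      unfolding islimpt_approachable
    proof (intro allI impI)
      fix e :: real assume e: "e > 0"
      show "\<exists>x'\<in>{r + of_real x | x. - Re r < x}. x' \<noteq> \<xi> \<and> dist x' \<xi> < e"
        using e x0 by (intro bexI[of _ "r + of_real (x0 + e / 2)"])
          (auto simp: \<xi>_def dist_norm intro!: exI[of _ "x0 + e / 2"])
    qed
    then have "f w - (r + of_real c * (w - r)) = 0"
    proof (rule analytic_continuation[where S = half_plane and \<xi> = \<xi> and f = "\<lambda>w. f w - (r + of_real c * (w - r))", rotated 5])
      show "{r + of_real x | x. - Re r < x} \<subseteq> half_plane" by auto
      show "f u - (r + of_real c * (u - r)) = 0" if u: "u \<in> {r + of_real x | x. - Re r < x}" for u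
      proof -
        obtain x where x: "u = r + of_real x" "- Re r < x" using u by auto
        have "f u = r + of_real (h x)" using f_h[OF x(2)] x(1) by (simp add: algebra_simps)
        then show ?thesis using x h by simp
      qed
    qed (use w x0 half_plane_open half_plane_connected in
        \<open>auto simp: \<xi>_def intro!: holomorphic_intros hol\<close>)
    then show ?thesis by simp
  qed
  moreover have "0 < c" using h_pos[OF x0(1)] x0 by (simp add: c_def)
  ultimately show ?thesis using that by blast
qed

text \<open>A contraction towards the boundary point \<open>r\<close> is invertible on the half-plane, and \<open>f\<close> commutes with
the inverse, which is an expansion.\<close>
lemma commute_with_dilation_half_plane:
  fixes L :: real and r :: complex
  assumes hol: "f holomorphic_on half_plane" and maps: "f ` half_plane \<subseteq> half_plane"
    and L: "0 < L" "L \<noteq> 1" and r: "Re r \<le> 0" "L < 1 \<Longrightarrow> Re r = 0"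
    and comm: "\<And>w. 0 < Re w \<Longrightarrow> f (r + of_real L * (w - r)) = r + of_real L * (f w - r)"
  obtains c :: real where "0 < c" "\<And>w. 0 < Re w \<Longrightarrow> f w = r + of_real c * (w - r)"
proof (cases "1 < L")
  case True
  then show ?thesis
    using commute_with_expansion_half_plane[OF hol maps True r(1) comm] that by blast
next
  case False
  with L have L1: "L < 1" by simp
  have "f (r + of_real (inverse L) * (w - r)) = r + of_real (inverse L) * (f w - r)"
    if w: "0 < Re w" for w
  proof -
    define v where "v = r + of_real (inverse L) * (w - r)"
    have "Re v > 0" using w L r(2)[OF L1] by (simp add: v_def)
    moreover have "r + of_real L * (v - r) = w"
      using L by (simp add: v_def field_simps)
    ultimately have "f w = r + of_real L * (f v - r)" using comm by metis
    then have "f v = r + of_real (inverse L) * (f w - r)" using L by (simp add: field_simps)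
    then show ?thesis by (simp add: v_def)
  qed
  moreover have "1 < inverse L" using L L1 by (simp add: one_less_inverse_iff)
  ultimately show ?thesis
    using commute_with_expansion_half_plane[OF hol maps _ r(1)] that by blast
qed

section \<open>The Cayley transform at a boundary point\<close>

text \<open>Maps the unit disk onto the right half-plane and the boundary point \<open>p\<close> to infinity.\<close>
definition cayley :: "complex \<Rightarrow> complex \<Rightarrow> complex"
  where "cayley p z = (p + z) / (p - z)"

definition cayley_inv :: "complex \<Rightarrow> complex \<Rightarrow> complex"
  where "cayley_inv p w = p * (w - 1) / (w + 1)"

lemma boundary_not_in_disk:
  assumes "norm p = 1" "z \<in> unit_disk"
  shows "p - z \<noteq> 0"
  using assms by auto

lemma cayley_in_half_plane:
  assumes p: "norm p = 1" and z: "z \<in> unit_disk"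
  shows "0 < Re (cayley p z)"
proof -
  have nz: "p - z \<noteq> 0" using boundary_not_in_disk[OF p z] .
  have "Re (cayley p z) = Re ((p + z) * cnj (p - z)) / (norm (p - z))\<^sup>2"
    unfolding cayley_def by (subst complex_div_cnj) (simp only: Re_divide_of_real of_real_power [symmetric])
  also have "Re ((p + z) * cnj (p - z)) = (norm p)\<^sup>2 - (norm z)\<^sup>2"
    unfolding cmod_power2 by (simp add: algebra_simps power2_eq_square)
  finally show ?thesis
    using p z nz by (simp add: abs_square_less_1 zero_less_divide_iff)
qed

lemma cayley_add_one:
  assumes "p - z \<noteq> 0"
  shows "cayley p z + 1 = 2 * p / (p - z)"
  using assms by (simp add: cayley_def field_simps)

lemma half_plane_add_one_nonzero: "0 < Re w \<Longrightarrow> w + 1 \<noteq> 0"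
  by (metis add.commute add_pos_pos less_irrefl one_complex.sel(1) plus_complex.sel(1) zero_complex.sel(1) zero_less_one)

lemma cayley_inv_cayley:
  assumes p: "norm p = 1" and z: "z \<in> unit_disk"
  shows "cayley_inv p (cayley p z) = z"
proof -
  have nz: "p - z \<noteq> 0" "p \<noteq> 0" using boundary_not_in_disk[OF p z] p by auto
  have "cayley p z - 1 = 2 * z / (p - z)"
    using nz by (simp add: cayley_def field_simps)
  then show ?thesis
    using nz unfolding cayley_inv_def cayley_add_one[OF nz(1)] by simp
qed

lemma cayley_cayley_inv:
  assumes p: "norm p = 1" and w: "w + 1 \<noteq> 0"
  shows "cayley p (cayley_inv p w) = w"
proof -
  have nz: "p \<noteq> 0" using p by auto
  have "p + cayley_inv p w = 2 * p * w / (w + 1)" "p - cayley_inv p w = 2 * p / (w + 1)"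
    using w by (simp_all add: cayley_inv_def field_simps)
  then show ?thesis
    using nz w unfolding cayley_def by simp
qed

lemma cayley_inv_in_disk:
  assumes p: "norm p = 1" and w: "0 < Re w"
  shows "cayley_inv p w \<in> unit_disk"
proof -
  have "norm (w - 1) < norm (w + 1)"
    using norm_diff_less_norm_add_cnj[OF w, of 1] by simp
  then show ?thesis
    using p by (simp add: cayley_inv_def norm_divide norm_mult divide_less_eq)
qed

lemma cayley_surj:
  assumes "norm p = 1" "0 < Re w"
  obtains z where "z \<in> unit_disk" "cayley p z = w"
  using assms that[of "cayley_inv p w"] cayley_inv_in_disk cayley_cayley_inv half_plane_add_one_nonzero
  by blast

lemma cayley_inj:
  assumes "norm p = 1" "z \<in> unit_disk" "w \<in> unit_disk" "cayley p z = cayley p w"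
  shows "z = w"
  using assms cayley_inv_cayley by metis

lemma dist_boundary_cayley:
  assumes "norm p = 1" "z \<in> unit_disk"
  shows "dist z p = 2 / norm (cayley p z + 1)"
  using assms boundary_not_in_disk[OF assms]
  by (simp add: cayley_add_one norm_divide norm_mult dist_norm norm_minus_commute)

lemma self_map_in_disk:
  assumes "self_map g" "z \<in> unit_disk"
  shows "g z \<in> unit_disk"
  using assms unfolding self_map_def by blast

lemma funpow_in_disk:
  assumes "self_map g" "z \<in> unit_disk"
  shows "(g ^^ n) z \<in> unit_disk"
  by (induction n) (use assms self_map_in_disk in \<open>auto simp del: mem_ball_0\<close>)

lemma transfer_to_half_plane:
  assumes f: "self_map f" and p: "norm p = 1"
  obtains g where "g holomorphic_on half_plane" "g ` half_plane \<subseteq> half_plane"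
    "\<And>z. z \<in> unit_disk \<Longrightarrow> g (cayley p z) = cayley p (f z)"
proof -
  define g where "g = cayley p \<circ> (f \<circ> cayley_inv p)"
  have inv: "cayley_inv p ` half_plane \<subseteq> unit_disk"
    using cayley_inv_in_disk[OF p] by blast
  have "cayley_inv p holomorphic_on half_plane"
    unfolding cayley_inv_def using half_plane_add_one_nonzero
    by (intro holomorphic_intros) auto
  moreover have "cayley p holomorphic_on unit_disk"
    unfolding cayley_def using boundary_not_in_disk[OF p]
    by (intro holomorphic_intros) auto
  ultimately have "g holomorphic_on half_plane"
    unfolding g_def using f inv unfolding self_map_def
    by (intro holomorphic_on_compose_gen[where t = unit_disk]) (auto simp: image_subset_iff)
  moreover have "g ` half_plane \<subseteq> half_plane"
  proof (clarify, unfold g_def comp_def)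
    fix w assume "0 < Re w"
    then show "0 < Re (cayley p (f (cayley_inv p w)))"
      by (intro cayley_in_half_plane[OF p] self_map_in_disk[OF f] cayley_inv_in_disk[OF p])
  qed
  moreover have "g (cayley p z) = cayley p (f z)" if "z \<in> unit_disk" for z
    using cayley_inv_cayley[OF p that] by (simp add: g_def)
  ultimately show ?thesis by (rule that)
qed

text \<open>A positive real factor is the only one that does not rotate or reflect the half-plane; the
imaginary direction and the two ends of the real axis each exclude one possibility.\<close>
lemma affine_preserving_half_plane:
  assumes l: "l \<noteq> 0" and maps: "\<And>w. 0 < Re w \<Longrightarrow> 0 < Re (l * w + b)"
  obtains L :: real where "0 < L" "l = of_real L" "0 \<le> Re b"
proof -
  have b: "0 \<le> Re b"
  proof (rule ccontr)
    assume "\<not> 0 \<le> Re b"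
    then have neg: "Re b < 0" by simp
    define t where "t = - Re b / (norm l + 1)"
    have n1: "norm l + 1 > 0" using norm_ge_zero[of l] by linarith
    have t: "0 < t" using neg n1 unfolding t_def by (simp add: divide_pos_pos divide_neg_pos)
    have "Re l * t \<le> norm l * t" using t complex_Re_le_cmod[of l] by simp
    also have "\<dots> < (norm l + 1) * t" using t by simp
    also have "\<dots> = - Re b" using n1 by (simp add: t_def)
    finally show False using maps[of "of_real t"] t by simp
  qed
  have Im: "Im l = 0"
  proof (rule ccontr)
    assume "Im l \<noteq> 0"
    then have "Re (l * Complex 1 ((Re l + Re b) / Im l) + b) = 0" by simp
    then show False using maps[of "Complex 1 ((Re l + Re b) / Im l)"] by simp
  qed
  have "0 \<le> Re l"
  proof (rule ccontr)
    assume "\<not> 0 \<le> Re l"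
    then have neg: "Re l < 0" by simp
    then have "0 < Re (l * of_real ((Re b + 1) / - Re l) + b)"
      using b by (intro maps) (simp add: divide_neg_neg divide_pos_neg)
    then show False using neg by simp
  qed
  moreover have "l = of_real (Re l)" using Im by (simp add: complex_eq_iff)
  moreover have "Re l \<noteq> 0" using l Im by (simp add: complex_eq_iff)
  ultimately show ?thesis using that[of "Re l"] b by linarith
qed

section \<open>Dynamic type of maps that are affine in the half-plane\<close>

text \<open>By \<open>dist_boundary_cayley\<close>, uniform convergence to \<open>p\<close> is uniform divergence to infinity in the
half-plane.\<close>
lemma denjoy_wolff_via_cayley:
  assumes g: "self_map g" and p: "norm p = 1"
    and escape: "\<And>K. compact K \<Longrightarrow> K \<subseteq> unit_disk \<Longrightarrow> K \<noteq> {} \<Longrightarrow>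
      \<exists>B. filterlim B at_top sequentially \<and> (\<forall>n. \<forall>z\<in>K. B n \<le> norm (cayley p ((g ^^ n) z) + 1))"
  shows "denjoy_wolff_point g p"
  unfolding denjoy_wolff_point_def
proof (intro conjI allI impI)
  fix K assume K: "compact K \<and> K \<subseteq> unit_disk"
  show "uniform_limit K (\<lambda>n. g ^^ n) (\<lambda>_. p) sequentially"
  proof (cases "K = {}")
    case False
    obtain B where B: "filterlim B at_top sequentially"
      "\<And>n z. z \<in> K \<Longrightarrow> B n \<le> norm (cayley p ((g ^^ n) z) + 1)"
      using escape K False by metis
    show ?thesis
    proof (rule uniform_limitI)
      fix e :: real assume e: "0 < e"
      have "\<forall>\<^sub>F n in sequentially. 2 / e < B n"
        using B(1) by (simp add: filterlim_at_top_dense)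
      then show "\<forall>\<^sub>F n in sequentially. \<forall>z\<in>K. dist ((g ^^ n) z) p < e"
      proof eventually_elim
        case (elim n)
        show ?case
        proof
          fix z assume z: "z \<in> K"
          have pos: "0 < 2 / e" using e by simp
          have lt: "2 / e < norm (cayley p ((g ^^ n) z) + 1)" using B(2)[OF z] elim by (rule less_le_trans[rotated])
          have "(g ^^ n) z \<in> unit_disk" using K z funpow_in_disk[OF g] by blast
          then have "dist ((g ^^ n) z) p = 2 / norm (cayley p ((g ^^ n) z) + 1)"
            by (rule dist_boundary_cayley[OF p])
          then show "dist ((g ^^ n) z) p < e"
            using lt e order.strict_trans[OF pos lt] by (simp add: divide_less_eq mult.commute)
        qed
      qed
    qed
  qed (simp add: uniform_limit_on_subset)
qed (rule p)

text \<open>The difference quotient at \<open>p\<close> equals a rational function that is continuous at \<open>p\<close>, so even the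
unrestricted limit within the disk exists.\<close>
lemma angular_derivative_via_cayley:
  fixes L :: real
  assumes g: "self_map g" and p: "norm p = 1" and L: "0 < L"
    and conj: "\<And>z. z \<in> unit_disk \<Longrightarrow> cayley p (g z) = of_real L * cayley p z + b"
  shows "has_angular_derivative g p (of_real (1 / L))"
  unfolding has_angular_derivative_def has_angular_limit_def
proof (intro exI[of _ p] conjI allI impI)
  fix M :: real
  define q where "q z = 2 * p / (of_real L * (p + z) + (b + 1) * (p - z))" for z
  have p0: "p \<noteq> 0" using p by auto
  have quotient: "(g z - p) / (z - p) = q z" if z: "z \<in> unit_disk" for z
  proof -
    have nz: "p - z \<noteq> 0" "p - g z \<noteq> 0"
      using boundary_not_in_disk[OF p z] boundary_not_in_disk[OF p self_map_in_disk[OF g z]] by auto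
    have "(g z - p) / (z - p) = (p - g z) / (p - z)"
      by (metis minus_diff_eq minus_divide_divide)
    moreover define A where "A = of_real L * (p + z) + (b + 1) * (p - z)"
    have "2 * p / (p - g z) = A / (p - z)"
      unfolding cayley_add_one[OF nz(2), symmetric] conj[OF z] A_def
      using nz(1) by (simp add: cayley_def field_simps)
    then have "2 * p * (p - z) = A * (p - g z)"
      using nz by (simp add: frac_eq_eq)
    moreover have "A \<noteq> 0" using calculation nz p0 by auto
    ultimately show ?thesis
      unfolding q_def A_def[symmetric] using nz by (metis frac_eq_eq mult.commute)
  qed
  have "(q \<longlongrightarrow> q p) (at p within stolz_region p M)"
    unfolding q_def using L p0 by (intro tendsto_intros) auto
  moreover have "q p = of_real (1 / L)" using L p0 by (simp add: q_def)
  moreover have "\<forall>\<^sub>F z in at p within stolz_region p M. q z = (g z - p) / (z - p)"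
    unfolding eventually_at_filter by (rule always_eventually) (auto simp: stolz_region_def quotient)
  ultimately show "((\<lambda>z. (g z - p) / (z - p)) \<longlongrightarrow> of_real (1 / L)) (at p within stolz_region p M)"
    using Lim_transform_eventually by metis
qed (rule p)

lemma affine_in_half_plane:
  assumes g: "self_map g" and p: "norm p = 1"
    and conj: "\<And>z. z \<in> unit_disk \<Longrightarrow> cayley p (g z) = l * cayley p z + b"
    and w: "0 < Re w"
  shows "0 < Re (l * w + b)"
proof -
  have z: "cayley_inv p w \<in> unit_disk" using cayley_inv_in_disk[OF p w] .
  have "cayley p (g (cayley_inv p w)) = l * w + b"
    using conj[OF z] cayley_cayley_inv[OF p half_plane_add_one_nonzero[OF w]] by simp
  then show ?thesis using cayley_in_half_plane[OF p self_map_in_disk[OF g z]] by simp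
qed

lemma hyperbolic_if_expanding:
  fixes L :: real
  assumes g: "self_map g" and p: "norm p = 1" and L: "1 < L"
    and conj: "\<And>z. z \<in> unit_disk \<Longrightarrow> cayley p (g z) = of_real L * cayley p z + b"
    and no_fix: "\<not> (\<exists>z\<in>unit_disk. g z = z)"
  shows "hyperbolic g"
proof -
  have "of_real L \<noteq> (0 :: complex)" using L by simp
  then have b: "0 \<le> Re b"
    by (rule affine_preserving_half_plane[OF _ affine_in_half_plane[OF g p conj]])
  have Re_iter: "L ^ n * Re (cayley p z) \<le> Re (cayley p ((g ^^ n) z))" if z: "z \<in> unit_disk" for n z
  proof (induction n)
    case (Suc n)
    have "Re (cayley p ((g ^^ Suc n) z)) = L * Re (cayley p ((g ^^ n) z)) + Re b"
      using conj[OF funpow_in_disk[OF g z]] by simp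
    moreover have "L * (L ^ n * Re (cayley p z)) \<le> L * Re (cayley p ((g ^^ n) z))"
      using Suc L by (intro mult_left_mono) auto
    ultimately show ?case using b by simp
  qed simp
  have "denjoy_wolff_point g p"
  proof (rule denjoy_wolff_via_cayley[OF g p])
    fix K assume K: "compact K" "K \<subseteq> unit_disk" "K \<noteq> {}"
    have "continuous_on K (\<lambda>z. Re (cayley p z))"
      unfolding cayley_def using boundary_not_in_disk[OF p subsetD[OF K(2)]]
      by (intro continuous_intros) blast
    then have "\<exists>z0\<in>K. \<forall>z\<in>K. Re (cayley p z0) \<le> Re (cayley p z)"
      by (rule continuous_attains_inf[OF K(1,3)])
    then obtain z0 where z0: "z0 \<in> K" "\<And>z. z \<in> K \<Longrightarrow> Re (cayley p z0) \<le> Re (cayley p z)"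
      by blast
    define m where "m = Re (cayley p z0)"
    have m: "0 < m" using cayley_in_half_plane[OF p] z0(1) K(2) unfolding m_def by blast
    have "filterlim (\<lambda>n. L ^ n * m) at_top sequentially"
    proof (rule filterlim_at_top_mult_tendsto_pos[OF tendsto_const m])
      show "filterlim (\<lambda>n. L ^ n) at_top sequentially"
        using L by (intro filterlim_at_infinity_imp_filterlim_at_top
            filterlim_realpow_sequentially_gt1 always_eventually) auto
    qed
    moreover have "L ^ n * m \<le> norm (cayley p ((g ^^ n) z) + 1)" if z: "z \<in> K" for n z
    proof -
      have "L ^ n * m \<le> L ^ n * Re (cayley p z)"
        using z0(2)[OF z] L unfolding m_def by (intro mult_left_mono) auto
      also have "\<dots> \<le> Re (cayley p ((g ^^ n) z))" using Re_iter z K(2) by blast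
      also have "\<dots> \<le> Re (cayley p ((g ^^ n) z) + 1)" by simp
      also have "\<dots> \<le> norm (cayley p ((g ^^ n) z) + 1)" by (rule complex_Re_le_cmod)
      finally show ?thesis .
    qed
    ultimately show "\<exists>B. filterlim B at_top sequentially \<and>
        (\<forall>n. \<forall>z\<in>K. B n \<le> norm (cayley p ((g ^^ n) z) + 1))"
      by blast
  qed
  moreover have "has_angular_derivative g p (of_real (1 / L))"
    using angular_derivative_via_cayley[OF g p _ conj] L by simp
  moreover have "1 / L < 1" using L by simp
  ultimately show ?thesis
    unfolding hyperbolic_def using g no_fix by blast
qed

lemma parabolic_if_translation:
  assumes g: "self_map g" and p: "norm p = 1" and b: "b \<noteq> 0"
    and conj: "\<And>z. z \<in> unit_disk \<Longrightarrow> cayley p (g z) = cayley p z + b"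
  shows "parabolic g"
proof -
  have iter: "cayley p ((g ^^ n) z) = cayley p z + of_nat n * b" if z: "z \<in> unit_disk" for n z
  proof (induction n)
    case (Suc n)
    then show ?case using conj[OF funpow_in_disk[OF g z]] by (simp add: algebra_simps)
  qed simp
  have "denjoy_wolff_point g p"
  proof (rule denjoy_wolff_via_cayley[OF g p])
    fix K assume K: "compact K" "K \<subseteq> unit_disk" "K \<noteq> {}"
    have "continuous_on K (\<lambda>z. cayley p z + 1)"
      unfolding cayley_def using boundary_not_in_disk[OF p subsetD[OF K(2)]]
      by (intro continuous_intros) blast
    then have "bounded ((\<lambda>z. cayley p z + 1) ` K)"
      using compact_continuous_image K(1) compact_imp_bounded by blast
    then obtain R where R: "\<And>z. z \<in> K \<Longrightarrow> norm (cayley p z + 1) \<le> R"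
      unfolding bounded_iff by blast
    have "filterlim (\<lambda>n. real n * norm b) at_top sequentially"
      using b by (intro filterlim_at_top_mult_tendsto_pos[OF tendsto_const] filterlim_real_sequentially) auto
    then have "filterlim (\<lambda>n. - R + real n * norm b) at_top sequentially"
      by (intro filterlim_tendsto_add_at_top[OF tendsto_const])
    moreover have "- R + real n * norm b \<le> norm (cayley p ((g ^^ n) z) + 1)" if z: "z \<in> K" for n z
    proof -
      have "real n * norm b = norm (of_nat n * b)" by (simp add: norm_mult)
      also have "\<dots> \<le> norm (of_nat n * b + (cayley p z + 1)) + norm (cayley p z + 1)"
        by (metis add_diff_cancel_right' norm_triangle_ineq4)
      also have "of_nat n * b + (cayley p z + 1) = cayley p ((g ^^ n) z) + 1"
        using iter z K(2) by (simp add: subset_iff)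
      finally show ?thesis using R[OF z] by linarith
    qed
    ultimately show "\<exists>B. filterlim B at_top sequentially \<and>
        (\<forall>n. \<forall>z\<in>K. B n \<le> norm (cayley p ((g ^^ n) z) + 1))"
      by blast
  qed
  moreover have "has_angular_derivative g p (of_real (1 / 1))"
    using conj by (intro angular_derivative_via_cayley[OF g p, of 1 b]) auto
  moreover have "\<not> (\<exists>z\<in>unit_disk. g z = z)"
  proof
    assume "\<exists>z\<in>unit_disk. g z = z"
    then obtain z where "z \<in> unit_disk" "g z = z" by blast
    then show False using conj[of z] b by simp
  qed
  ultimately show ?thesis
    unfolding parabolic_def using g by auto
qed

text \<open>The inverse translation also preserves the half-plane.\<close>
lemma automorphism_if_imaginary_translation:
  assumes g: "self_map g" and p: "norm p = 1" and b: "Re b = 0"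
    and conj: "\<And>z. z \<in> unit_disk \<Longrightarrow> cayley p (g z) = cayley p z + b"
  shows "disk_automorphism g"
  unfolding disk_automorphism_def bij_betw_def
proof (intro conjI)
  show "inj_on g unit_disk"
  proof (rule inj_onI)
    fix z w assume z: "z \<in> unit_disk" and w: "w \<in> unit_disk" and "g z = g w"
    then have "cayley p z = cayley p w" using conj[OF z] conj[OF w] by simp
    then show "z = w" by (rule cayley_inj[OF p z w])
  qed
  show "g ` unit_disk = unit_disk"
  proof
    show "g ` unit_disk \<subseteq> unit_disk" using self_map_in_disk[OF g] by blast
    show "unit_disk \<subseteq> g ` unit_disk"
    proof
      fix y assume y: "y \<in> unit_disk"
      define w where "w = cayley p y - b"
      have w: "0 < Re w" using cayley_in_half_plane[OF p y] b by (simp add: w_def)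
      define z where "z = cayley_inv p w"
      have z: "z \<in> unit_disk" unfolding z_def by (rule cayley_inv_in_disk[OF p w])
      have "cayley p z = w" unfolding z_def
        by (rule cayley_cayley_inv[OF p half_plane_add_one_nonzero[OF w]])
      then have "cayley p (g z) = cayley p y" using conj[OF z] by (simp add: w_def)
      then have "g z = y" using cayley_inj[OF p self_map_in_disk[OF g z] y] by simp
      then show "y \<in> g ` unit_disk" using z by blast
    qed
  qed
qed (rule g)

text \<open>\<open>b / (1 - L)\<close> is the finite fixed point of \<open>w \<mapsto> L w + b\<close>; inside the half-plane it would be a fixed
point of \<open>g\<close> in the disk.\<close>
lemma fixed_point_outside_half_plane:
  fixes L :: real
  assumes g: "self_map g" and p: "norm p = 1" and L: "L \<noteq> 1"
    and conj: "\<And>z. z \<in> unit_disk \<Longrightarrow> cayley p (g z) = of_real L * cayley p z + b"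
    and no_fix: "\<not> (\<exists>z\<in>unit_disk. g z = z)"
  shows "Re (b / of_real (1 - L)) \<le> 0"
proof (rule ccontr)
  assume "\<not> ?thesis"
  then have r: "0 < Re (b / of_real (1 - L))" by simp
  define r where "r = b / of_real (1 - L)"
  have r0: "0 < Re r" using r by (simp only: r_def)
  have fixed: "of_real L * r + b = r"
  proof -
    have "(of_real (1 - L) :: complex) \<noteq> 0" using L by simp
    then have "r * of_real (1 - L) = b" unfolding r_def by simp
    then show ?thesis by (simp add: algebra_simps)
  qed
  have z: "cayley_inv p r \<in> unit_disk" by (rule cayley_inv_in_disk[OF p r0])
  have "cayley p (cayley_inv p r) = r" by (rule cayley_cayley_inv[OF p half_plane_add_one_nonzero[OF r0]])
  then have "cayley p (g (cayley_inv p r)) = cayley p (cayley_inv p r)"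
    using conj[OF z] fixed by simp
  then have "g (cayley_inv p r) = cayley_inv p r"
    by (rule cayley_inj[OF p self_map_in_disk[OF g z] z])
  with z no_fix show False by blast
qed

text \<open>For \<open>L < 1\<close> the point \<open>p\<close> is repelling. The finite fixed point \<open>r\<close> of the affine map then lies on the
imaginary axis and corresponds to a second boundary fixed point \<open>p'\<close>, which is attracting: the
coordinate sending \<open>p'\<close> to infinity is an affine function of \<open>1 / (w - r)\<close> and so gets multiplied by
\<open>1 / L > 1\<close>.\<close>
lemma hyperbolic_if_affine:
  fixes L :: real
  assumes g: "self_map g" and p: "norm p = 1" and L: "0 < L" "L \<noteq> 1"
    and conj: "\<And>z. z \<in> unit_disk \<Longrightarrow> cayley p (g z) = of_real L * cayley p z + b"
    and no_fix: "\<not> (\<exists>z\<in>unit_disk. g z = z)"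
  shows "hyperbolic g" "L < 1 \<Longrightarrow> Re b = 0"
proof -
  have "of_real L \<noteq> (0 :: complex)" using L by simp
  then have b: "0 \<le> Re b"
    by (rule affine_preserving_half_plane[OF _ affine_in_half_plane[OF g p conj]])
  show Re_b: "Re b = 0" if "L < 1"
  proof -
    have "Re b / (1 - L) \<le> 0"
      using fixed_point_outside_half_plane[OF g p L(2) conj no_fix]
      by (simp only: Re_divide_of_real)
    then show ?thesis using b that by (simp add: divide_le_0_iff)
  qed
  show "hyperbolic g"
  proof (cases "1 < L")
    case True
    then show ?thesis by (rule hyperbolic_if_expanding[OF g p _ conj no_fix])
  next
    case False
    with L have L1: "L < 1" by simp
    define r where "r = b / of_real (1 - L)"
    have r: "Re r = 0" using Re_b[OF L1] unfolding r_def by (simp only: Re_divide_of_real)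
    have b_r: "b = r * (1 - of_real L)"
    proof -
      have "(of_real (1 - L) :: complex) \<noteq> 0" using L by simp
      then show ?thesis unfolding r_def by simp
    qed
    define p' where "p' = cayley_inv p r"
    have r1: "r + 1 \<noteq> 0" using r by (auto simp: complex_eq_iff)
    have "norm (r - 1) = norm (r + 1)"
      using r by (simp add: cmod_def)
    moreover have "norm (r + 1) \<noteq> 0" using r1 by simp
    ultimately have p': "norm p' = 1"
      using p unfolding p'_def cayley_inv_def by (simp add: norm_divide norm_mult)
    have swap: "cayley p' z = (1 - r * r) / (cayley p z - r) - r" and sep: "cayley p z - r \<noteq> 0"
      if z: "z \<in> unit_disk" for z
    proof -
      define w where "w = cayley p z"
      have w: "0 < Re w" unfolding w_def by (rule cayley_in_half_plane[OF p z])
      have w1: "w + 1 \<noteq> 0" by (rule half_plane_add_one_nonzero[OF w])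
      have wr: "w - r \<noteq> 0" using w r by auto
      show "cayley p z - r \<noteq> 0" using wr unfolding w_def .
      have z_w: "z = p * (w - 1) / (w + 1)"
        using cayley_inv_cayley[OF p z] unfolding w_def cayley_inv_def by simp
      have p0: "p \<noteq> 0" using p by auto
      have "p' + z = 2 * p * (r * w - 1) / ((r + 1) * (w + 1))"
        unfolding z_w p'_def cayley_inv_def using r1 w1 by (simp add: field_simps)
      moreover have "p' - z = 2 * p * (r - w) / ((r + 1) * (w + 1))"
        unfolding z_w p'_def cayley_inv_def using r1 w1 by (simp add: field_simps)
      ultimately have "cayley p' z = (r * w - 1) / (r - w)"
        unfolding cayley_def using p0 r1 w1 by simp
      also have "\<dots> = (1 - r * r) / (w - r) - r"
        using wr by (simp add: divide_simps) (simp add: algebra_simps)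
      finally show "cayley p' z = (1 - r * r) / (cayley p z - r) - r" by (simp only: w_def)
    qed
    have "cayley p' (g z) = of_real (1 / L) * cayley p' z + (r / of_real L - r)"
      if z: "z \<in> unit_disk" for z
    proof -
      have "cayley p (g z) - r = of_real L * (cayley p z - r)"
        unfolding conj[OF z] b_r by (simp add: algebra_simps)
      moreover have "A / (of_real L * s) - r = of_real (1 / L) * (A / s - r) + (r / of_real L - r)"
        if "s \<noteq> 0" for A s :: complex
        using that L by (simp add: field_simps)
      ultimately show ?thesis
        unfolding swap[OF z] swap[OF self_map_in_disk[OF g z]] using sep[OF z] by metis
    qed
    moreover have "1 < 1 / L" using L L1 by simp
    ultimately show ?thesis
      using hyperbolic_if_expanding[OF g p' _ _ no_fix] by blast
  qed
qed

section \<open>Fixed points in the disk\<close>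

lemma disk_moebius_inj:
  assumes \<phi>: "disk_moebius a b c d \<phi>" and z: "z \<in> unit_disk" and w: "w \<in> unit_disk"
    and eq: "\<phi> z = \<phi> w"
  shows "z = w"
proof -
  have det: "a * d - b * c \<noteq> 0" and nz: "c * z + d \<noteq> 0" "c * w + d \<noteq> 0"
    using \<phi> z w by (auto simp: disk_moebius_def)
  have "(a * z + b) / (c * z + d) = (a * w + b) / (c * w + d)"
    using \<phi> z w eq by (simp add: disk_moebius_def)
  then have "(a * z + b) * (c * w + d) = (a * w + b) * (c * z + d)"
    using nz by (simp add: frac_eq_eq)
  then have "(a * d - b * c) * (z - w) = 0" by algebra
  with det show ?thesis by simp
qed

lemma moebius_function_inj:
  assumes a: "norm a < 1" and z: "norm z < 1" and w: "norm w < 1"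
    and eq: "Moebius_function 0 a z = Moebius_function 0 a w"
  shows "z = w"
proof -
  have "Moebius_function 0 (- a) (Moebius_function 0 a u) = u" if "norm u < 1" for u
    using a that by (intro Moebius_function_compose) auto
  then show ?thesis using z w eq by metis
qed

text \<open>Moving \<open>z0\<close> to 0 by a disk automorphism leaves the derivative at the fixed point unchanged and
reduces both claims to the Schwarz lemma at 0; a second fixed point is a case of equality there.\<close>
lemma schwarz_at_fixed_point:
  assumes g: "self_map g" and z0: "z0 \<in> unit_disk" "g z0 = z0"
  shows "norm (deriv g z0) \<le> 1"
    and "norm (deriv g z0) = 1 \<or> (\<exists>z1\<in>unit_disk. z1 \<noteq> z0 \<and> g z1 = z1) \<Longrightarrow>
      norm (deriv g z0) = 1 \<and>
      (\<forall>z\<in>unit_disk. Moebius_function 0 z0 (g z) = deriv g z0 * Moebius_function 0 z0 z)"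
proof -
  define M where "M = Moebius_function 0 z0"
  define M' where "M' = Moebius_function 0 (- z0)"
  have n: "norm z0 < 1" using z0 by simp
  have M_disk: "norm (M z) < 1" "norm (M' z) < 1" if "norm z < 1" for z
    using Moebius_function_norm_lt_1 n that unfolding M_def M'_def by simp_all
  have M'_M: "M' (M z) = z" if "norm z < 1" for z
    unfolding M_def M'_def using n that by (intro Moebius_function_compose) auto
  have M'0: "M' 0 = z0" and M0: "M z0 = 0"
    by (simp_all add: M_def M'_def Moebius_function_simple)
  have g_disk: "norm (g z) < 1" if "norm z < 1" for z
    using self_map_in_disk[OF g, of z] that by simp
  define h where "h = M \<circ> (g \<circ> M')"
  have h_eq: "h z = M (g (M' z))" for z by (simp add: h_def)
  have hol: "h holomorphic_on ball 0 1"
    unfolding h_def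
  proof (intro holomorphic_on_compose_gen[where t = unit_disk])
    show "M' holomorphic_on ball 0 1" "M holomorphic_on unit_disk"
      unfolding M_def M'_def using n by (auto intro!: Moebius_function_holomorphic)
    show "g holomorphic_on unit_disk" using g by (simp add: self_map_def)
    show "M' ` ball 0 1 \<subseteq> unit_disk" using M_disk by auto
    then show "(g \<circ> M') ` ball 0 1 \<subseteq> unit_disk" using M_disk g_disk by auto
  qed
  have h0: "h 0 = 0" by (simp add: h_eq M'0 M0 z0)
  have h_disk: "norm (h z) < 1" if "norm z < 1" for z
    using that by (simp add: h_eq M_disk g_disk)
  have deriv_h: "deriv h 0 = deriv g z0"
  proof (rule DERIV_imp_deriv)
    define q where "q = 1 - cnj z0 * z0"
    have "norm (cnj z0 * z0) < 1" using n by (simp add: norm_mult abs_square_less_1 flip: power2_eq_square)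
    then have q: "q \<noteq> 0" unfolding q_def by auto
    have "(g has_field_derivative deriv g z0) (at z0)"
      using g z0 unfolding self_map_def by (intro holomorphic_derivI[of g unit_disk]) auto
    moreover have "(M' has_field_derivative q) (at 0)"
      unfolding M'_def Moebius_function_simple[abs_def] q_def
      by (auto intro!: derivative_eq_intros simp: algebra_simps)
    moreover have "(M has_field_derivative 1 / q) (at z0)"
      unfolding M_def Moebius_function_simple[abs_def]
      using q unfolding q_def by (auto intro!: derivative_eq_intros)
    ultimately have "(h has_field_derivative 1 / q * (deriv g z0 * q)) (at 0)"
      unfolding h_def by (intro DERIV_chain) (simp_all add: M'0 z0)
    then show "(h has_field_derivative deriv g z0) (at 0)" using q by simp
  qed
  note schwarz = Schwarz_Lemma[OF hol h0 h_disk, of 0]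
  show "norm (deriv g z0) \<le> 1" using schwarz(2) deriv_h by simp
  assume "norm (deriv g z0) = 1 \<or> (\<exists>z1\<in>unit_disk. z1 \<noteq> z0 \<and> g z1 = z1)"
  then have "(\<exists>z. norm z < 1 \<and> z \<noteq> 0 \<and> norm (h z) = norm z) \<or> norm (deriv h 0) = 1"
  proof
    assume "\<exists>z1\<in>unit_disk. z1 \<noteq> z0 \<and> g z1 = z1"
    then obtain z1 where z1: "norm z1 < 1" "z1 \<noteq> z0" "g z1 = z1" by auto
    have "h (M z1) = M z1" using z1 by (simp add: h_eq M'_M)
    moreover have "M z1 \<noteq> 0" using M'_M[OF z1(1)] M'0 z1(2) by auto
    ultimately show ?thesis using M_disk(1)[OF z1(1)] by metis
  qed (simp add: deriv_h)
  then obtain \<alpha> where \<alpha>: "\<And>z. norm z < 1 \<Longrightarrow> h z = \<alpha> * z" "norm \<alpha> = 1"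
    using schwarz(3) by auto
  have "deriv h 0 = \<alpha>"
  proof (rule DERIV_imp_deriv)
    have "((\<lambda>z. \<alpha> * z) has_field_derivative \<alpha>) (at 0)"
      by (auto intro!: derivative_eq_intros)
    then show "(h has_field_derivative \<alpha>) (at 0)"
      by (rule has_field_derivative_transform_within_open[of _ _ _ unit_disk]) (auto simp: \<alpha>)
  qed
  moreover have "M (g z) = \<alpha> * M z" if "z \<in> unit_disk" for z
    using \<alpha>(1)[OF M_disk(1)[of z]] M'_M[of z] that by (simp add: h_eq)
  ultimately show "norm (deriv g z0) = 1 \<and>
      (\<forall>z\<in>unit_disk. Moebius_function 0 z0 (g z) = deriv g z0 * Moebius_function 0 z0 z)"
    using \<alpha>(2) deriv_h unfolding M_def by auto
qed

lemma identity_if_derivative_one: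
  assumes g: "self_map g" and z0: "z0 \<in> unit_disk" "g z0 = z0" and d: "deriv g z0 = 1"
  shows "identity_on_disk g"
  unfolding identity_on_disk_def
proof
  fix z assume z: "z \<in> unit_disk"
  have "Moebius_function 0 z0 (g z) = Moebius_function 0 z0 z"
    using schwarz_at_fixed_point(2)[OF g z0] d z by simp
  then show "g z = z"
    using moebius_function_inj[of z0 "g z" z] z0(1) z self_map_in_disk[OF g z] by simp
qed

lemma identity_if_two_fixed_points:
  assumes g: "self_map g" and z0: "z0 \<in> unit_disk" "g z0 = z0"
    and z1: "z1 \<in> unit_disk" "g z1 = z1" "z1 \<noteq> z0"
  shows "identity_on_disk g"
proof -
  have "Moebius_function 0 z0 z1 = deriv g z0 * Moebius_function 0 z0 z1"
    using schwarz_at_fixed_point(2)[OF g z0] z1 by metis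
  moreover have "Moebius_function 0 z0 z1 \<noteq> 0"
    using moebius_function_inj[of z0 z1 z0] z0 z1 by (auto simp: Moebius_function_eq_zero)
  ultimately have "deriv g z0 = 1" by simp
  then show ?thesis by (rule identity_if_derivative_one[OF g z0])
qed

lemma automorphism_if_unimodular_derivative:
  assumes g: "self_map g" and z0: "z0 \<in> unit_disk" "g z0 = z0" and d: "norm (deriv g z0) = 1"
  shows "disk_automorphism g"
  unfolding disk_automorphism_def bij_betw_def
proof (intro conjI)
  define \<alpha> where "\<alpha> = deriv g z0"
  define M where "M = Moebius_function 0 z0"
  define M' where "M' = Moebius_function 0 (- z0)"
  have n: "norm z0 < 1" using z0 by simp
  have \<alpha>: "norm \<alpha> = 1" "\<alpha> \<noteq> 0" using d unfolding \<alpha>_def by auto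
  have M_g: "M (g z) = \<alpha> * M z" if "z \<in> unit_disk" for z
    using schwarz_at_fixed_point(2)[OF g z0] d that by (simp add: M_def \<alpha>_def)
  have inj: "z = w" if "z \<in> unit_disk" "w \<in> unit_disk" "M z = M w" for z w
    using moebius_function_inj[of z0 z w] n that by (simp add: M_def)
  show "inj_on g unit_disk"
  proof (rule inj_onI)
    fix z w assume z: "z \<in> unit_disk" and w: "w \<in> unit_disk" and "g z = g w"
    then have "\<alpha> * M z = \<alpha> * M w" using M_g[OF z] M_g[OF w] by metis
    then show "z = w" using inj[OF z w] \<alpha>(2) by (auto simp only: mult_cancel_left)
  qed
  show "g ` unit_disk = unit_disk"
  proof
    show "g ` unit_disk \<subseteq> unit_disk" using self_map_in_disk[OF g] by blast
    show "unit_disk \<subseteq> g ` unit_disk"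
    proof
      fix y assume y: "y \<in> unit_disk"
      define u where "u = M y / \<alpha>"
      have u: "norm u < 1"
        using \<alpha> y n Moebius_function_norm_lt_1 by (simp add: u_def norm_divide M_def)
      have z: "M' u \<in> unit_disk"
        using Moebius_function_norm_lt_1[of "- z0" u 0] n u by (simp add: M'_def)
      have "M (M' u) = u"
        unfolding M_def M'_def using n u by (intro Moebius_function_compose) auto
      then have "M (g (M' u)) = M y" using M_g[OF z] \<alpha> by (simp add: u_def)
      then have "g (M' u) = y" using inj[OF self_map_in_disk[OF g z] y] by simp
      then show "y \<in> g ` unit_disk" using z by blast
    qed
  qed
qed (rule g)

text \<open>With \<open>h\<close> and \<open>e\<close> the numerator and denominator of \<open>k(z)\<close>, commutation makes \<open>h / e\<close> invariant under
\<open>\<phi>\<close>. Points near \<open>z0\<close> are attracted to \<open>z0\<close>, where \<open>h / e\<close> has a limit by l'Hospital's rule.\<close>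
lemma commutant_elliptic:
  assumes \<phi>: "disk_moebius a b c d \<phi>" "self_map \<phi>" and f: "self_map f" "\<not> identity_on_disk f"
    and comm: "\<And>z. z \<in> unit_disk \<Longrightarrow> f (\<phi> z) = \<phi> (f z)"
    and z0: "z0 \<in> unit_disk" "\<phi> z0 = z0" "f z0 = z0"
    and attr: "norm (deriv \<phi> z0) < 1"
  obtains k where "\<And>z. z \<in> unit_disk \<Longrightarrow> f z * (c * z + d) - (a * z + b) = k * (z - f z)"
proof -
  define h where "h z = f z * (c * z + d) - (a * z + b)" for z
  define e where "e z = z - f z" for z
  have f_hol: "f holomorphic_on unit_disk" and \<phi>_hol: "\<phi> holomorphic_on unit_disk"
    using f \<phi> by (auto simp: self_map_def)
  have den: "c * z + d \<noteq> 0" "\<phi> z * (c * z + d) = a * z + b" if "z \<in> unit_disk" for z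
    using \<phi>(1) that by (auto simp: disk_moebius_def)
  have e_nz: "e z \<noteq> 0" if "z \<in> unit_disk" "z \<noteq> z0" for z
    using identity_if_two_fixed_points[OF f(1) z0(1,3) that(1) _ that(2)] f(2) by (auto simp: e_def)
  have invariant: "h (\<phi> z) * e z = h z * e (\<phi> z)" if z: "z \<in> unit_disk" for z
  proof -
    define x where "x = f z"
    define y where "y = \<phi> z"
    define w where "w = \<phi> x"
    have x_disk: "x \<in> unit_disk" unfolding x_def by (rule self_map_in_disk[OF f(1) z])
    have fy: "f y = w" using comm[OF z] by (simp add: x_def y_def w_def)
    have eqs: "y * (c * z + d) = a * z + b" "w * (c * x + d) = a * x + b"
      using den(2)[OF z] den(2)[OF x_disk] by (simp_all add: y_def w_def)
    \<comment> \<open>Under \<open>\<phi>\<close> both \<open>h\<close> and \<open>e\<close> are multiplied by \<open>(a d - b c) / ((c z + d) (c x + d))\<close>.\<close>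
    have "((w * (c * y + d) - (a * y + b)) * (z - x) - (x * (c * z + d) - (a * z + b)) * (y - w))
        * ((c * z + d) * (c * x + d)) = 0"
      using eqs by algebra
    then have "(w * (c * y + d) - (a * y + b)) * (z - x) = (x * (c * z + d) - (a * z + b)) * (y - w)"
      using den(1)[OF z] den(1)[OF x_disk] by simp
    then show ?thesis
      unfolding h_def e_def x_def[symmetric] y_def[symmetric] fy by simp
  qed
  have df: "(f has_field_derivative deriv f z0) (at z0)"
    using f_hol z0(1) by (intro holomorphic_derivI[of f unit_disk]) auto
  obtain h' where h': "(h has_field_derivative h') (at z0)"
  proof -
    have "h holomorphic_on unit_disk" unfolding h_def by (intro holomorphic_intros f_hol)
    then show ?thesis using that z0(1) by (meson holomorphic_derivI open_ball)
  qed
  have e': "(e has_field_derivative 1 - deriv f z0) (at z0)"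
    unfolding e_def by (intro derivative_intros df)
  have e'_nz: "1 - deriv f z0 \<noteq> 0"
    using identity_if_derivative_one[OF f(1) z0(1,3)] f(2) by auto
  have h_z0: "h z0 = 0" and e_z0: "e z0 = 0"
    using den(2)[OF z0(1)] z0 by (simp_all add: h_def e_def)
  define k where "k = h' / (1 - deriv f z0)"
  have lim: "((\<lambda>w. h w / e w) \<longlongrightarrow> k) (at z0)"
    using lhopital_complex_simple[OF h' e' h_z0 e_z0 e'_nz] by (simp add: k_def)
  obtain \<rho> where \<rho>: "norm (deriv \<phi> z0) < \<rho>" "\<rho> < 1" using dense[OF attr] by blast
  have \<rho>0: "0 < \<rho>" using \<rho>(1) norm_ge_zero le_less_trans by blast
  have "(\<phi> has_field_derivative deriv \<phi> z0) (at z0)"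
    using \<phi>_hol z0(1) by (intro holomorphic_derivI[of \<phi> unit_disk]) auto
  then have "((\<lambda>z. norm ((\<phi> z - z0) / (z - z0))) \<longlongrightarrow> norm (deriv \<phi> z0)) (at z0)"
    unfolding has_field_derivative_iff z0(2) by (rule tendsto_norm)
  then have "\<forall>\<^sub>F z in at z0. norm ((\<phi> z - z0) / (z - z0)) < \<rho>"
    using \<rho>(1) by (rule order_tendstoD(2))
  then obtain r1 where r1: "0 < r1"
      "\<And>z. z \<noteq> z0 \<Longrightarrow> dist z z0 < r1 \<Longrightarrow> norm ((\<phi> z - z0) / (z - z0)) < \<rho>"
    unfolding eventually_at by blast
  obtain r2 where r2: "0 < r2" "ball z0 r2 \<subseteq> unit_disk"
    using z0(1) open_ball[of 0 1] unfolding open_contains_ball by blast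
  define r where "r = min r1 r2"
  have r: "0 < r" "ball z0 r \<subseteq> unit_disk" using r1 r2 by (auto simp: r_def)
  have contract: "norm (\<phi> z - z0) \<le> \<rho> * norm (z - z0)" if "z \<in> ball z0 r" for z
  proof (cases "z = z0")
    case False
    then have "norm ((\<phi> z - z0) / (z - z0)) < \<rho>"
      using r1(2) that by (simp add: r_def dist_commute)
    then show ?thesis using False by (simp add: norm_divide divide_less_eq)
  qed (simp add: z0)
  have ratio: "h z / e z = k" if z: "z \<in> ball z0 r" "z \<noteq> z0" for z
  proof -
    have iter: "(\<phi> ^^ n) z \<in> unit_disk \<and> (\<phi> ^^ n) z \<noteq> z0 \<and>
        norm ((\<phi> ^^ n) z - z0) \<le> \<rho> ^ n * norm (z - z0) \<and>
        h ((\<phi> ^^ n) z) / e ((\<phi> ^^ n) z) = h z / e z" for n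
    proof (induction n)
      case 0
      then show ?case using z r(2) by auto
    next
      case (Suc n)
      define u where "u = (\<phi> ^^ n) z"
      have u: "u \<in> unit_disk" "u \<noteq> z0" "norm (u - z0) \<le> \<rho> ^ n * norm (z - z0)" "h u / e u = h z / e z"
        using Suc by (auto simp: u_def)
      have "\<rho> ^ n * norm (z - z0) \<le> 1 * norm (z - z0)"
        using \<rho> \<rho>0 by (intro mult_right_mono) (auto intro: power_le_one)
      then have "u \<in> ball z0 r" using u(3) z(1) by (simp add: dist_norm norm_minus_commute)
      then have "norm (\<phi> u - z0) \<le> \<rho> * norm (u - z0)" by (rule contract)
      also have "\<dots> \<le> \<rho> * (\<rho> ^ n * norm (z - z0))" using u(3) \<rho>0 by simp
      finally have 1: "norm (\<phi> u - z0) \<le> \<rho> ^ Suc n * norm (z - z0)" by simp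
      have 2: "\<phi> u \<in> unit_disk" by (rule self_map_in_disk[OF \<phi>(2) u(1)])
      have 3: "\<phi> u \<noteq> z0" using disk_moebius_inj[OF \<phi>(1) u(1) z0(1)] u(2) z0(2) by auto
      have "h (\<phi> u) / e (\<phi> u) = h u / e u"
        using invariant[OF u(1)] e_nz[OF u(1,2)] e_nz[OF 2 3] by (simp add: frac_eq_eq)
      then show ?case using 1 2 3 u(4) by (simp add: u_def)
    qed
    have "(\<lambda>n. \<rho> ^ n * norm (z - z0)) \<longlonglongrightarrow> 0 * norm (z - z0)"
      using \<rho> \<rho>0 by (intro tendsto_intros LIMSEQ_realpow_zero) auto
    then have "(\<lambda>n. \<rho> ^ n * norm (z - z0)) \<longlonglongrightarrow> 0" by simp
    then have "(\<lambda>n. (\<phi> ^^ n) z - z0) \<longlonglongrightarrow> 0"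
      by (rule Lim_null_comparison[rotated]) (use iter in auto)
    then have "(\<lambda>n. (\<phi> ^^ n) z) \<longlonglongrightarrow> z0" by (simp add: LIM_zero_iff)
    then have "filterlim (\<lambda>n. (\<phi> ^^ n) z) (at z0) sequentially"
      using iter by (simp add: filterlim_at)
    from filterlim_compose[OF lim this] show ?thesis
      using iter LIMSEQ_unique[OF tendsto_const] by simp
  qed
  have local: "h z = k * e z" if z: "z \<in> ball z0 r" for z
  proof (cases "z = z0")
    case False
    then show ?thesis using ratio[OF z False] e_nz[of z] r(2) z by (auto simp: field_simps)
  qed (simp add: h_z0 e_z0)
  have "h z = k * e z" if "z \<in> unit_disk" for z
  proof (rule analytic_continuation_open[of "ball z0 r" unit_disk h "\<lambda>z. k * e z"])
    show "h holomorphic_on unit_disk" "(\<lambda>z. k * e z) holomorphic_on unit_disk"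
      unfolding h_def e_def by (intro holomorphic_intros f_hol)+
  qed (use r local that in auto)
  then show ?thesis unfolding h_def e_def by (rule that)
qed

section \<open>Fixed points on the circle\<close>

text \<open>The bound \<open>|a z + b| \<le> |c z + d|\<close> extends to the closed disk. There it excludes poles, as numerator
and denominator would vanish together, so the transformation is a continuous self-map of the closed
disk and Brouwer's theorem applies.\<close>
lemma boundary_fixed_point:
  assumes \<phi>: "disk_moebius a b c d \<phi>" "self_map \<phi>"
    and no_fix: "\<not> (\<exists>z\<in>unit_disk. \<phi> z = z)"
  obtains p where "norm p = 1" "c * p + d \<noteq> 0" "a * p + b = p * (c * p + d)"
proof -
  have det: "a * d - b * c \<noteq> 0" using \<phi> by (simp add: disk_moebius_def)
  have le: "norm (a * z + b) \<le> norm (c * z + d)" if z: "z \<in> cball 0 1" for z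
  proof -
    have "norm (a * z + b) - norm (c * z + d) \<le> 0" if "z \<in> unit_disk" for z
    proof -
      have "c * z + d \<noteq> 0" "norm ((a * z + b) / (c * z + d)) < 1"
        using self_map_in_disk[OF \<phi>(2) that] \<phi>(1) that by (auto simp: disk_moebius_def)
      then show ?thesis by (simp add: norm_divide divide_less_eq)
    qed
    moreover have "continuous_on (closure unit_disk) (\<lambda>z. norm (a * z + b) - norm (c * z + d))"
      by (intro continuous_intros)
    moreover have "z \<in> closure unit_disk" using z by simp
    ultimately have "norm (a * z + b) - norm (c * z + d) \<le> 0"
      using continuous_le_on_closure[where f = "\<lambda>z. norm (a * z + b) - norm (c * z + d)"] by blast
    then show ?thesis by simp
  qed
  have den: "c * z + d \<noteq> 0" if z: "z \<in> cball 0 1" for z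
  proof
    assume 0: "c * z + d = 0"
    then have "a * z + b = 0" using le[OF z] by simp
    with 0 have "a * d - b * c = 0" by algebra
    with det show False by simp
  qed
  define \<psi> where "\<psi> z = (a * z + b) / (c * z + d)" for z
  have "continuous_on (cball 0 1) \<psi>"
    unfolding \<psi>_def using den by (intro continuous_intros) auto
  moreover have "\<psi> \<in> cball 0 1 \<rightarrow> cball 0 1"
    using le den by (auto simp: \<psi>_def norm_divide divide_le_eq)
  ultimately obtain p where p: "p \<in> cball 0 1" "\<psi> p = p"
    by (rule brouwer_ball[OF zero_less_one])
  have "p \<notin> unit_disk"
  proof
    assume "p \<in> unit_disk"
    moreover from this have "\<phi> p = p" using \<phi>(1) p(2) by (simp add: disk_moebius_def \<psi>_def)
    ultimately show False using no_fix by blast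
  qed
  then have "norm p = 1" using p(1) by simp
  moreover have "a * p + b = p * (c * p + d)"
    using p(2) den[OF p(1)] by (simp add: \<psi>_def divide_eq_eq)
  ultimately show ?thesis using that den[OF p(1)] by blast
qed

text \<open>The difference formula for a transformation, with one of the two points being its fixed point \<open>p\<close>.\<close>
lemma disk_moebius_boundary_difference:
  assumes \<phi>: "disk_moebius a b c d \<phi>" and z: "z \<in> unit_disk"
    and p: "a * p + b = p * (c * p + d)"
  shows "(p - \<phi> z) * ((c * p + d) * (c * z + d)) = (a * d - b * c) * (p - z)"
proof -
  have "\<phi> z * (c * z + d) = a * z + b"
    using \<phi> z by (auto simp: disk_moebius_def)
  then show ?thesis using p by algebra
qed

text \<open>The conjugated transformation fixes infinity, so it is affine. The multiplier
\<open>l = (c p + d)\<^sup>2 / (a d - b c)\<close> is the inverse of the derivative of \<open>\<phi>\<close> at \<open>p\<close>.\<close>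
lemma affine_at_boundary_fixed_point:
  assumes \<phi>: "disk_moebius a b c d \<phi>" "self_map \<phi>"
    and p: "norm p = 1" "c * p + d \<noteq> 0" "a * p + b = p * (c * p + d)"
  obtains l e where "l \<noteq> 0" "\<And>z. z \<in> unit_disk \<Longrightarrow> cayley p (\<phi> z) = l * cayley p z + e"
proof -
  define \<Delta> where "\<Delta> = a * d - b * c"
  have \<Delta>: "\<Delta> \<noteq> 0" using \<phi> by (simp add: disk_moebius_def \<Delta>_def)
  define l where "l = (c * p + d)\<^sup>2 / \<Delta>"
  define m where "m = 2 * p * c * (c * p + d) / \<Delta>"
  have "cayley p (\<phi> z) = l * cayley p z + (l - m - 1)" if z: "z \<in> unit_disk" for z
  proof -
    have nz: "p - z \<noteq> 0" "p - \<phi> z \<noteq> 0"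
      using boundary_not_in_disk[OF p(1) z] boundary_not_in_disk[OF p(1) self_map_in_disk[OF \<phi>(2) z]] by auto
    have den: "c * z + d \<noteq> 0" using \<phi> z by (auto simp: disk_moebius_def)
    have diff: "(p - \<phi> z) * ((c * p + d) * (c * z + d)) = \<Delta> * (p - z)"
      unfolding \<Delta>_def by (rule disk_moebius_boundary_difference[OF \<phi>(1) z p(3)])
    have "cayley p (\<phi> z) + 1 = 2 * p / (p - \<phi> z)" by (rule cayley_add_one[OF nz(2)])
    also have "\<dots> = 2 * p * ((c * p + d) * (c * z + d)) / (\<Delta> * (p - z))"
      unfolding diff[symmetric] using p(2) den by simp
    also have "c * z + d = (c * p + d) - c * (p - z)" by algebra
    also have "2 * p * ((c * p + d) * ((c * p + d) - c * (p - z))) / (\<Delta> * (p - z))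
        = l * (2 * p / (p - z)) - m"
      using nz(1) \<Delta> by (simp add: l_def m_def field_simps power2_eq_square)
    also have "2 * p / (p - z) = cayley p z + 1" by (rule cayley_add_one[OF nz(1), symmetric])
    finally show ?thesis by (simp add: algebra_simps)
  qed
  moreover have "l \<noteq> 0" using p(2) \<Delta> by (simp add: l_def)
  ultimately show ?thesis using that by blast
qed

text \<open>The quotient \<open>(f - \<phi>) / (z - f)\<close> changes under a Cayley transform by the factor
\<open>(p - \<phi> z) / (p - z)\<close>, which is a constant divided by \<open>c z + d\<close>. So \<open>k\<close> is constant if and only if
the same quotient is constant in the half-plane coordinate.\<close>
lemma commutant_via_cayley:
  assumes \<phi>: "disk_moebius a b c d \<phi>" "self_map \<phi>" and f: "self_map f"
    and p: "norm p = 1" "c * p + d \<noteq> 0" "a * p + b = p * (c * p + d)"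
    and K: "\<And>z. z \<in> unit_disk \<Longrightarrow> cayley p (f z) - cayley p (\<phi> z) = K * (cayley p z - cayley p (f z))"
  obtains k where "\<And>z. z \<in> unit_disk \<Longrightarrow> f z * (c * z + d) - (a * z + b) = k * (z - f z)"
proof -
  define k where "k = K * (a * d - b * c) / (c * p + d)"
  have "f z * (c * z + d) - (a * z + b) = k * (z - f z)" if z: "z \<in> unit_disk" for z
  proof -
    define x where "x = f z"
    define y where "y = \<phi> z"
    have nz: "p - z \<noteq> 0" "p - y \<noteq> 0" "p - x \<noteq> 0" "p \<noteq> 0"
      using boundary_not_in_disk[OF p(1) z] boundary_not_in_disk[OF p(1) self_map_in_disk[OF \<phi>(2) z]]
        boundary_not_in_disk[OF p(1) self_map_in_disk[OF f z]] p(1) by (auto simp: x_def y_def)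
    have den: "c * z + d \<noteq> 0" "y * (c * z + d) = a * z + b"
      using \<phi>(1) z by (auto simp: disk_moebius_def y_def)
    have diff: "cayley p u - cayley p v = 2 * p * (u - v) / ((p - u) * (p - v))"
      if "p - u \<noteq> 0" "p - v \<noteq> 0" for u v
      using that by (simp add: cayley_def divide_simps) (simp add: algebra_simps)
    have "2 * p * (x - y) / ((p - x) * (p - y)) = K * (2 * p * (z - x) / ((p - z) * (p - x)))"
      using K[OF z] nz by (simp add: diff flip: x_def y_def)
    moreover have "X * C = K * Y * B"
      if "X / (A * B) = K * (Y / (C * A))" "A \<noteq> 0" "B \<noteq> 0" "C \<noteq> 0" for X Y A B C :: complex
      using that by (simp add: field_simps)
    ultimately have "2 * p * (x - y) * (p - z) = K * (2 * p * (z - x)) * (p - y)"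
      using nz by metis
    then have "2 * p * ((x - y) * (p - z)) = 2 * p * (K * (z - x) * (p - y))"
      by (simp only: mult_ac)
    then have "(x - y) * (p - z) = K * (z - x) * (p - y)"
      using nz(4) by simp
    moreover have "(p - y) * ((c * p + d) * (c * z + d)) = (a * d - b * c) * (p - z)"
      unfolding y_def by (rule disk_moebius_boundary_difference[OF \<phi>(1) z p(3)])
    ultimately have "((x * (c * z + d) - (a * z + b)) * (c * p + d) - K * (a * d - b * c) * (z - x)) * (p - z) = 0"
      using den(2) by algebra
    then have "(x * (c * z + d) - (a * z + b)) * (c * p + d) = K * (a * d - b * c) * (z - x)"
      using nz by simp
    then have "x * (c * z + d) - (a * z + b) = k * (z - x)"
      using p(2) by (simp add: k_def divide_simps mult_ac)
    then show ?thesis by (simp add: x_def)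
  qed
  then show ?thesis using that by blast
qed

section \<open>Maps commuting with a linear fractional self-map\<close>

text \<open>The case \<open>L = 1\<close> is the parabolic one. There an imaginary translation \<open>e\<close> would make \<open>\<phi>\<close> an
automorphism, which leaves \<open>Re e > 0\<close>. The value 1 of the multiplier \<open>s\<close>, or 0 of the translation
\<open>t\<close>, would make \<open>f\<close> the identity.\<close>
lemma commuting_without_interior_fixed_point:
  assumes \<phi>: "disk_moebius a b c d \<phi>" "self_map \<phi>" and f: "self_map f" "\<not> identity_on_disk f"
    and no_fix: "\<not> (\<exists>z\<in>unit_disk. \<phi> z = z)"
    and not_par: "\<not> (parabolic \<phi> \<and> disk_automorphism \<phi>)"
    and comm: "\<And>z. z \<in> unit_disk \<Longrightarrow> f (\<phi> z) = \<phi> (f z)"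
  obtains k where "\<And>z. z \<in> unit_disk \<Longrightarrow> f z * (c * z + d) - (a * z + b) = k * (z - f z)"
    "same_dynamic_type f \<phi>"
proof -
  obtain p where p: "norm p = 1" "c * p + d \<noteq> 0" "a * p + b = p * (c * p + d)"
    using boundary_fixed_point[OF \<phi> no_fix] .
  obtain l e where l: "l \<noteq> 0" and conj: "\<And>z. z \<in> unit_disk \<Longrightarrow> cayley p (\<phi> z) = l * cayley p z + e"
    using affine_at_boundary_fixed_point[OF \<phi> p] by blast
  obtain L where L: "0 < L" "l = of_real L" and e: "0 \<le> Re e"
    using affine_preserving_half_plane[OF l affine_in_half_plane[OF \<phi>(2) p(1) conj]] .
  note conj_L = conj[unfolded L(2)]
  obtain g where g: "g holomorphic_on half_plane" "g ` half_plane \<subseteq> half_plane"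
    and g_f: "\<And>z. z \<in> unit_disk \<Longrightarrow> g (cayley p z) = cayley p (f z)"
    using transfer_to_half_plane[OF f(1) p(1)] by blast
  have comm_g: "g (of_real L * w + e) = of_real L * g w + e" if "0 < Re w" for w
  proof -
    obtain z where z: "z \<in> unit_disk" "cayley p z = w"
      using cayley_surj[OF p(1) \<open>0 < Re w\<close>] .
    have "g (cayley p (\<phi> z)) = cayley p (\<phi> (f z))"
      using g_f[OF self_map_in_disk[OF \<phi>(2) z(1)]] comm[OF z(1)] by simp
    then show ?thesis
      using conj_L[OF z(1)] conj_L[OF self_map_in_disk[OF f(1) z(1)]] z(2) g_f[OF z(1)] by simp
  qed
  show ?thesis
  proof (cases "L = 1")
    case True
    have e_nz: "e \<noteq> 0"
    proof
      assume "e = 0"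
      then have "cayley p (\<phi> 0) = cayley p 0" using conj_L[of 0] True by simp
      then have "\<phi> 0 = 0" using cayley_inj[OF p(1) self_map_in_disk[OF \<phi>(2)], of 0 0] by simp
      then show False using no_fix by auto
    qed
    have conj1: "cayley p (\<phi> z) = cayley p z + e" if "z \<in> unit_disk" for z
      using conj_L[OF that] True by simp
    have par: "parabolic \<phi>" by (rule parabolic_if_translation[OF \<phi>(2) p(1) e_nz conj1])
    have "Re e \<noteq> 0"
      using automorphism_if_imaginary_translation[OF \<phi>(2) p(1) _ conj1] par not_par by blast
    with e have e_pos: "0 < Re e" by simp
    obtain t where t: "\<And>w. 0 < Re w \<Longrightarrow> g w = w + t"
      using commute_with_translation_half_plane[OF g e_pos] comm_g True by auto
    have conj_f: "cayley p (f z) = cayley p z + t" if "z \<in> unit_disk" for z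
      using g_f[OF that] t[OF cayley_in_half_plane[OF p(1) that]] by simp
    have t_nz: "t \<noteq> 0"
    proof
      assume "t = 0"
      then have "f z = z" if "z \<in> unit_disk" for z
        using conj_f[OF that] cayley_inj[OF p(1) self_map_in_disk[OF f(1) that] that] by simp
      then show False using f(2) by (simp add: identity_on_disk_def)
    qed
    have "parabolic f" by (rule parabolic_if_translation[OF f(1) p(1) t_nz conj_f])
    moreover obtain k where "\<And>z. z \<in> unit_disk \<Longrightarrow> f z * (c * z + d) - (a * z + b) = k * (z - f z)"
    proof (rule commutant_via_cayley[OF \<phi> f(1) p])
      show "cayley p (f z) - cayley p (\<phi> z) = ((e - t) / t) * (cayley p z - cayley p (f z))"
        if "z \<in> unit_disk" for z
        using t_nz by (simp add: conj_f[OF that] conj1[OF that])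
    qed blast
    ultimately show ?thesis using that par unfolding same_dynamic_type_def by blast
  next
    case False
    define r where "r = e / of_real (1 - L)"
    have e_r: "e = r * (1 - of_real L)"
    proof -
      have "(of_real (1 - L) :: complex) \<noteq> 0" using False by simp
      then show ?thesis unfolding r_def by simp
    qed
    have hyp: "hyperbolic \<phi>" and Re_e: "L < 1 \<Longrightarrow> Re e = 0"
      using hyperbolic_if_affine[OF \<phi>(2) p(1) L(1) False conj_L no_fix] by auto
    have Re_r: "Re r \<le> 0"
      unfolding r_def by (rule fixed_point_outside_half_plane[OF \<phi>(2) p(1) False conj_L no_fix])
    have Re_r0: "Re r = 0" if "L < 1"
      using Re_e[OF that] unfolding r_def by (simp only: Re_divide_of_real)
    have comm_r: "g (r + of_real L * (w - r)) = r + of_real L * (g w - r)" if "0 < Re w" for w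
      using comm_g[OF that] unfolding e_r by (simp add: algebra_simps)
    obtain s :: real where s: "0 < s" "\<And>w. 0 < Re w \<Longrightarrow> g w = r + of_real s * (w - r)"
      using commute_with_dilation_half_plane[OF g L(1) False Re_r Re_r0 comm_r] by blast
    have conj_f: "cayley p (f z) = of_real s * cayley p z + r * (1 - of_real s)" if "z \<in> unit_disk" for z
      using g_f[OF that] s(2)[OF cayley_in_half_plane[OF p(1) that]] by (simp add: algebra_simps)
    have s1: "s \<noteq> 1"
    proof
      assume "s = 1"
      then have "f z = z" if "z \<in> unit_disk" for z
        using conj_f[OF that] cayley_inj[OF p(1) self_map_in_disk[OF f(1) that] that] by simp
      then show False using f(2) by (simp add: identity_on_disk_def)
    qed
    then have s1c: "1 - of_real s \<noteq> (0 :: complex)" by simp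
    have no_fix_f: "\<not> (\<exists>z\<in>unit_disk. f z = z)"
    proof
      assume "\<exists>z\<in>unit_disk. f z = z"
      then obtain z where z: "z \<in> unit_disk" "f z = z" by blast
      have "(1 - of_real s) * (cayley p z - r) = 0"
        using conj_f[OF z(1)] z(2) by (simp add: algebra_simps)
      then have "cayley p z = r" using s1c by simp
      then show False using cayley_in_half_plane[OF p(1) z(1)] Re_r by simp
    qed
    have "hyperbolic f" by (rule hyperbolic_if_affine(1)[OF f(1) p(1) s(1) s1 conj_f no_fix_f])
    moreover obtain k where "\<And>z. z \<in> unit_disk \<Longrightarrow> f z * (c * z + d) - (a * z + b) = k * (z - f z)"
    proof (rule commutant_via_cayley[OF \<phi> f(1) p])
      show "cayley p (f z) - cayley p (\<phi> z)
          = ((of_real s - of_real L) / (1 - of_real s)) * (cayley p z - cayley p (f z))"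
        if "z \<in> unit_disk" for z
      proof -
        have 1: "cayley p (f z) - cayley p (\<phi> z) = (of_real s - of_real L) * (cayley p z - r)"
          unfolding conj_f[OF that] conj_L[OF that] e_r by (simp add: algebra_simps)
        have 2: "cayley p z - cayley p (f z) = (1 - of_real s) * (cayley p z - r)"
          unfolding conj_f[OF that] by (simp add: algebra_simps)
        show ?thesis unfolding 1 2 using s1c by simp
      qed
    qed blast
    ultimately show ?thesis using that hyp unfolding same_dynamic_type_def by blast
  qed
qed

lemma commuting_with_interior_fixed_point:
  assumes \<phi>: "disk_moebius a b c d \<phi>" "self_map \<phi>" "\<not> identity_on_disk \<phi>"
    and not_aut: "\<not> (elliptic \<phi> \<and> disk_automorphism \<phi>)"
    and f: "self_map f" "\<not> identity_on_disk f"
    and z0: "z0 \<in> unit_disk" "\<phi> z0 = z0"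
    and comm: "\<And>z. z \<in> unit_disk \<Longrightarrow> f (\<phi> z) = \<phi> (f z)"
  obtains k where "\<And>z. z \<in> unit_disk \<Longrightarrow> f z * (c * z + d) - (a * z + b) = k * (z - f z)"
    "same_dynamic_type f \<phi>"
proof -
  have ell: "elliptic \<phi>" using \<phi> z0 unfolding elliptic_def by blast
  have f_z0: "f z0 = z0"
  proof (rule ccontr)
    assume ne: "f z0 \<noteq> z0"
    have "\<phi> (f z0) = f z0" using comm[OF z0(1)] z0(2) by simp
    then have "identity_on_disk \<phi>"
      using identity_if_two_fixed_points[OF \<phi>(2) z0 self_map_in_disk[OF f(1) z0(1)] _ ne] by simp
    with \<phi>(3) show False by simp
  qed
  have "norm (deriv \<phi> z0) \<noteq> 1"
    using automorphism_if_unimodular_derivative[OF \<phi>(2) z0] ell not_aut by blast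
  then have "norm (deriv \<phi> z0) < 1"
    using schwarz_at_fixed_point(1)[OF \<phi>(2) z0] by simp
  then obtain k where "\<And>z. z \<in> unit_disk \<Longrightarrow> f z * (c * z + d) - (a * z + b) = k * (z - f z)"
    using commutant_elliptic[OF \<phi>(1,2) f comm z0 f_z0] by blast
  moreover have "elliptic f" using f z0 f_z0 unfolding elliptic_def by blast
  ultimately show ?thesis using that ell unfolding same_dynamic_type_def by blast
qed

theorem theorem8:
  fixes \<phi> f :: "complex \<Rightarrow> complex" and \<Phi> :: "sphere \<Rightarrow> sphere"
  assumes "self_map \<phi>"
    and "linear_fractional \<Phi>" and "extends_to_sphere \<phi> \<Phi>"
    and "\<not> identity_on_disk \<phi>"
    and "\<not> (elliptic \<phi> \<and> disk_automorphism \<phi>)"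
    and "\<not> (parabolic \<phi> \<and> disk_automorphism \<phi>)"
    and "self_map f"
    and "\<not> f constant_on unit_disk"
    and "\<not> identity_on_disk f"
  shows "((\<forall>z\<in>unit_disk. f (\<phi> z) = \<phi> (f z)) \<longleftrightarrow>
          (\<exists>F. linear_fractional F \<and> extends_to_sphere f F \<and> fixed_points F = fixed_points \<Phi>))
    \<and> ((\<forall>z\<in>unit_disk. f (\<phi> z) = \<phi> (f z)) \<longrightarrow> same_dynamic_type f \<phi>)"
proof -
  obtain a b c d where det: "a * d - b * c \<noteq> 0" and \<Phi>: "\<Phi> = moebius a b c d"
    using assms(2) unfolding linear_fractional_def by blast
  have \<phi>: "disk_moebius a b c d \<phi>"
    using det assms(3) unfolding \<Phi> disk_moebius_iff_extends by blast
  have forward: "(\<exists>F. linear_fractional F \<and> extends_to_sphere f F \<and> fixed_points F = fixed_points \<Phi>)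
      \<and> same_dynamic_type f \<phi>" if "\<forall>z\<in>unit_disk. f (\<phi> z) = \<phi> (f z)"
  proof -
    have comm: "\<And>z. z \<in> unit_disk \<Longrightarrow> f (\<phi> z) = \<phi> (f z)" using that by blast
    obtain k where k: "\<And>z. z \<in> unit_disk \<Longrightarrow> f z * (c * z + d) - (a * z + b) = k * (z - f z)"
      and type: "same_dynamic_type f \<phi>"
    proof (cases "\<exists>z\<in>unit_disk. \<phi> z = z")
      case True
      then obtain z0 where z0: "z0 \<in> unit_disk" "\<phi> z0 = z0" by blast
      show ?thesis
        by (rule commuting_with_interior_fixed_point[OF \<phi> assms(1,4,5,7,9) z0 comm]) (assumption, rule that)
    next
      case False
      show ?thesis
        by (rule commuting_without_interior_fixed_point[OF \<phi> assms(1,7,9) False assms(6) comm]) (assumption, rule that)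
    qed
    have "f holomorphic_on unit_disk" using assms(7) by (simp add: self_map_def)
    note F = commutant_imp_same_fixed_points[OF \<phi> assms(4) this assms(8) k]
    show ?thesis
    proof (intro conjI exI)
      show "linear_fractional (moebius (a + k) b c (d + k))"
        using F unfolding disk_moebius_def linear_fractional_def by blast
      show "extends_to_sphere f (moebius (a + k) b c (d + k))"
        using F unfolding disk_moebius_iff_extends by blast
      show "fixed_points (moebius (a + k) b c (d + k)) = fixed_points \<Phi>"
        using F unfolding \<Phi> by blast
    qed (rule type)
  qed
  have backward: "\<forall>z\<in>unit_disk. f (\<phi> z) = \<phi> (f z)"
    if ex: "\<exists>F. linear_fractional F \<and> extends_to_sphere f F \<and> fixed_points F = fixed_points \<Phi>"
  proof -
    obtain F where F: "linear_fractional F" "extends_to_sphere f F" "fixed_points F = fixed_points \<Phi>"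
      using ex by blast
    obtain a' b' c' d' where F': "a' * d' - b' * c' \<noteq> 0" "F = moebius a' b' c' d'"
      using F(1) unfolding linear_fractional_def by blast
    have f: "disk_moebius a' b' c' d' f"
      using F(2) F' unfolding disk_moebius_iff_extends by blast
    have same: "fixed_points (moebius a' b' c' d') = fixed_points (moebius a b c d)"
      using F(3) unfolding F'(2) \<Phi> .
    have maps: "\<phi> ` unit_disk \<subseteq> unit_disk" "f ` unit_disk \<subseteq> unit_disk"
      using assms(1,7) by (simp_all add: self_map_def)
    show ?thesis
      using commute_if_same_fixed_points[OF \<phi> f maps assms(4) same] by blast
  qed
  show ?thesis
    by (intro conjI iffI impI)
      (erule forward[THEN conjunct1] backward forward[THEN conjunct2])+
qed

end
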